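(* Let $\alpha\in(0,1)$ and $K=K_0+K_1$ with $K_0,K_1\ge1$. Assume that, independently for $k=1,\dots,K$, the training data are drawn from the model with repeated measurements $$X_k\sim P_X,\qquad N_k\mid X_k\sim P_{N|X},\qquad Y_{k,1},\dots,Y_{k,N_k}\mid (X_k,N_k)\ \overset{\mathrm{iid}}{\sim}\ P_{Y|X}\ (\text{at } X=X_k),$$ and that the test point is drawn independently from $X_{\mathrm{test}}\sim P_X$, $Y_{\mathrm{test}}\mid X_{\mathrm{test}}\sim P_{Y|X}$. Let $\widehat C$ be the HCP$^2$ prediction set at level $\alpha$ and let $\alpha_{\mathcal D}(x)$ be its miscoverage rate conditional on the data $\mathcal D$ and on $X_{\mathrm{test}}=x$. Then $$\mathbb E_{P_X^{\ge2}}\big[\alpha_{\mathcal D}(X_{\mathrm{test}})^2\big]\le\alpha^2 .$$ Moreover, if all scores $s(Z_{k,i})$ are distinct almost surely, then additionally $$\mathbb E_{P_X^{\ge2}}\big[\alpha_{\mathcal D}(X_{\mathrm{test}})^2\big]\ \ge\ \alpha^2-\frac{2}{(K_1+1)\,p_{\ge2}} .$$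
   Context: Setting. $P$ is a distribution on $\mathcal Z=\mathcal X\times\mathcal Y$ with marginal $P_X$ of $X$ and conditional distribution $P_{Y|X}$; $P_{N|X}$ is a conditional distribution on $\mathbb N=\{1,2,\dots\}$. Write $Z_{k,i}=(X_k,Y_{k,i})$ and $\tilde Z_k=(Z_{k,1},\dots,Z_{k,N_k})$. The groups $k=1,\dots,K_0$ are used for training and $k=K_0+1,\dots,K$ for calibration. $\mathcal D=\{(X_k,Y_{k,1},\dots,Y_{k,N_k})\}_{k=1,\dots,K}$ denotes all training and calibration data. Reweighting. It is assumed that $p_{\ge2}=\mathbb P\{N\ge2\}>0$, where $(X,N)\sim P_X\times P_{N|X}$ (i.e. $X\sim P_X$, $N\mid X\sim P_{N|X}$). $P_X^{\ge2}$ is the conditional distribution of $X$ given $N\ge2$ under this joint model. $\mathbb E_{P_X^{\ge2}}[\cdot]$ denotes expectation when $\mathcal D$ is drawn from the repeated-measurements model (independently for $k=1,\dots,K$: $X_k\sim P_X$, $N_k\mid X_k\sim P_{N|X}$, and $Y_{k,1},\dots,Y_{k,N_k}\mid(X_k,N_k)$ i.i.d. from $P_{Y|X}$ at $X=X_k$) and $X_{\mathrm{test}}$ is drawn independently of $\mathcal D$ from $P_X^{\ge2}$ (instead of $P_X$). Conditional miscoverage. $\alpha_{\mathcal D}(x)=\mathbb P\{Y_{\mathrm{test}}\notin\widehat C(X_{\mathrm{test}})\mid\mathcal D;\,X_{\mathrm{test}}=x\}$, where $Y_{\mathrm{test}}$ is drawn from $P_{Y|X}$ at $X=x$. Quantile.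 $\delta_t$ is the point mass at $t$; for a distribution $P$ on $\mathbb R\cup\{+\infty\}$ and $\beta\in(0,1)$, $Q_{\beta}(P)=\inf\{t\in\mathbb R:\mathbb P_{T\sim P}\{T\le t\}\ge\beta\}$, with $\inf\emptyset=+\infty$. HCP$^2$ at level $\alpha$. A (measurable) score function $s:\mathcal Z\to\mathbb R$ is constructed by an arbitrary procedure as a function of $\tilde Z_1,\dots,\tilde Z_{K_0}$ only. Let $K_1^{\ge2}=\sum_{k=K_0+1}^K\mathbf 1\{N_k\ge2\}$, and let $s_{k,(1)}\le\dots\le s_{k,(N_k)}$ be the order statistics of $s(Z_{k,1}),\dots,s(Z_{k,N_k})$. Then $\widehat C(x)=\{y\in\mathcal Y:s(x,y)\le T\}$ with $$T=Q_{1-\alpha^2}\Big(\sum_{\substack{k=K_0+1,\dots,K\\N_k\ge2}}\ \sum_{i=1}^{N_k}\frac{N_k-i}{(K_1^{\ge2}+1)\binom{N_k}{2}}\,\delta_{s_{k,(i)}}+\frac1{K_1^{\ge2}+1}\,\delta_{+\infty}\Big).$$ The condition that all scores are distinct almost surely refers to the scores $s(Z_{k,i})$, $k=K_0+1,\dots,K+1$, $i=1,\dots,N_k$, where $(X_{K+1},N_{K+1},Y_{K+1,1},\dots,Y_{K+1,N_{K+1}})$ is one further independent draw from the repeated-measurements model, representing the test group. *)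

theory Defs
  imports "HOL-Probability.Probability"
begin

section \<open>Groups of repeated measurements\<close>

text \<open>A group \<open>(X, Y\<^sub>1, \<dots>, Y\<^sub>N)\<close> is a pair \<open>(x, ys)\<close>; its size \<open>N\<close> is \<open>length ys\<close>.\<close>

type_synonym ('x, 'y) grp = "'x \<times> 'y list"

abbreviation grp_size :: "('x, 'y) grp \<Rightarrow> nat" where
  "grp_size g \<equiv> length (snd g)"

definition obs :: "('x, 'y) grp \<Rightarrow> nat \<Rightarrow> 'x \<times> 'y" where
  "obs g i = (fst g, snd g ! (i - 1))"

text \<open>The \<open>\<sigma>\<close>-algebra of the disjoint union of the powers \<open>M\<^sup>n\<close>, generated by the
  rectangles \<open>A\<^sub>1 \<times> \<dots> \<times> A\<^sub>n\<close> for all \<open>n\<close>.\<close>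

definition list_space :: "'a measure \<Rightarrow> 'a list measure" where
  "list_space M = sigma (lists (space M)) {listset As |As. As \<in> lists (sets M)}"

definition grp_space :: "'x measure \<Rightarrow> 'y measure \<Rightarrow> ('x, 'y) grp measure" where
  "grp_space MX MY = MX \<Otimes>\<^sub>M list_space MY"

definition iid_list :: "nat \<Rightarrow> 'a measure \<Rightarrow> 'a list measure" where
  "iid_list n P = distr (\<Pi>\<^sub>M i\<in>{1..n}. P) (list_space P) (\<lambda>\<omega>. map \<omega> [1..<Suc n])"

definition grp_law ::
  "'x measure \<Rightarrow> 'y measure \<Rightarrow> 'x measure \<Rightarrow> ('x \<Rightarrow> nat measure) \<Rightarrow> ('x \<Rightarrow> 'y measure)
    \<Rightarrow> ('x, 'y) grp measure" where
  "grp_law MX MY PX PN PY = do {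
     x \<leftarrow> PX;
     n \<leftarrow> PN x;
     ys \<leftarrow> iid_list n (PY x);
     return (grp_space MX MY) (x, ys)
   }"

definition data_law ::
  "'x measure \<Rightarrow> 'y measure \<Rightarrow> 'x measure \<Rightarrow> ('x \<Rightarrow> nat measure) \<Rightarrow> ('x \<Rightarrow> 'y measure)
    \<Rightarrow> nat \<Rightarrow> (nat \<Rightarrow> ('x, 'y) grp) measure" where
  "data_law MX MY PX PN PY K = (\<Pi>\<^sub>M k\<in>{1..K}. grp_law MX MY PX PN PY)"


section \<open>Conditioning on at least two measurements\<close>

definition XN_law :: "'x measure \<Rightarrow> ('x \<Rightarrow> nat measure) \<Rightarrow> ('x \<times> nat) measure" where
  "XN_law PX PN = do {
     x \<leftarrow> PX;
     n \<leftarrow> PN x;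
     return (PX \<Otimes>\<^sub>M count_space {1..}) (x, n)
   }"

definition p_ge2 :: "'x measure \<Rightarrow> ('x \<Rightarrow> nat measure) \<Rightarrow> real" where
  "p_ge2 PX PN = \<P>(\<omega> in XN_law PX PN. 2 \<le> snd \<omega>)"

text \<open>\<open>uniform_measure\<close> is the library's conditioning of a measure on an event.\<close>

definition PX_ge2 :: "'x measure \<Rightarrow> ('x \<Rightarrow> nat measure) \<Rightarrow> 'x measure" where
  "PX_ge2 PX PN =
     distr (uniform_measure (XN_law PX PN) {\<omega> \<in> space (XN_law PX PN). 2 \<le> snd \<omega>}) PX fst"


section \<open>Quantiles and the prediction set\<close>

definition quantile :: "real \<Rightarrow> ereal measure \<Rightarrow> ereal" where
  "quantile \<beta> P = Inf (ereal ` {t. \<beta> \<le> \<P>(u in P. u \<le> ereal t)})"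

text \<open>\<open>weighted_atoms I w v\<close> is the measure \<open>\<Sum>j\<in>I. w j * \<delta> (v j)\<close>.\<close>

definition weighted_atoms :: "'i set \<Rightarrow> ('i \<Rightarrow> real) \<Rightarrow> ('i \<Rightarrow> ereal) \<Rightarrow> ereal measure" where
  "weighted_atoms I w v = distr (point_measure I (\<lambda>j. ennreal (w j))) borel v"

definition order_stat :: "('x \<times> 'y \<Rightarrow> real) \<Rightarrow> ('x, 'y) grp \<Rightarrow> nat \<Rightarrow> real" where
  "order_stat s g i = sort (map (\<lambda>j. s (obs g j)) [1..<Suc (grp_size g)]) ! (i - 1)"

definition cal_groups :: "nat \<Rightarrow> nat \<Rightarrow> (nat \<Rightarrow> ('x, 'y) grp) \<Rightarrow> nat set" where
  "cal_groups K0 K D = {k \<in> {K0+1..K}. 2 \<le> grp_size (D k)}"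

text \<open>\<open>Some (k, i)\<close> indexes the atom at the \<open>i\<close>-th order statistic of group \<open>k\<close>, and \<open>None\<close>
  the atom at infinity.\<close>

definition hcp2_measure ::
  "('x \<times> 'y \<Rightarrow> real) \<Rightarrow> nat \<Rightarrow> nat \<Rightarrow> (nat \<Rightarrow> ('x, 'y) grp) \<Rightarrow> ereal measure" where
  "hcp2_measure s K0 K D =
     (let G = cal_groups K0 K D; m = real (card G)
      in weighted_atoms
           (insert None (Some ` (SIGMA k:G. {1..grp_size (D k)})))
           (\<lambda>j. case j of
                  None \<Rightarrow> 1 / (m + 1)
                | Some (k, i) \<Rightarrow>
                    real (grp_size (D k) - i) / ((m + 1) * real (grp_size (D k) choose 2)))
           (\<lambda>j. case j of None \<Rightarrow> \<infinity> | Some (k, i) \<Rightarrow> ereal (order_stat s (D k) i)))"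

text \<open>In the following, \<open>S\<close> is the procedure that constructs the score function; it is given
  only the training groups \<open>1, \<dots>, K0\<close> of the data.\<close>

definition fitted_score ::
  "((nat \<Rightarrow> ('x, 'y) grp) \<Rightarrow> 'x \<times> 'y \<Rightarrow> real) \<Rightarrow> nat \<Rightarrow> (nat \<Rightarrow> ('x, 'y) grp) \<Rightarrow> 'x \<times> 'y \<Rightarrow> real"
  where
  "fitted_score S K0 D = S (restrict D {1..K0})"

definition hcp2_threshold ::
  "((nat \<Rightarrow> ('x, 'y) grp) \<Rightarrow> 'x \<times> 'y \<Rightarrow> real) \<Rightarrow> nat \<Rightarrow> nat \<Rightarrow> real \<Rightarrow> (nat \<Rightarrow> ('x, 'y) grp) \<Rightarrow> ereal"
  where
  "hcp2_threshold S K0 K \<alpha> D = quantile (1 - \<alpha>\<^sup>2) (hcp2_measure (fitted_score S K0 D) K0 K D)"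

definition hcp2_set ::
  "'y measure \<Rightarrow> ((nat \<Rightarrow> ('x, 'y) grp) \<Rightarrow> 'x \<times> 'y \<Rightarrow> real) \<Rightarrow> nat \<Rightarrow> nat \<Rightarrow> real
    \<Rightarrow> (nat \<Rightarrow> ('x, 'y) grp) \<Rightarrow> 'x \<Rightarrow> 'y set" where
  "hcp2_set MY S K0 K \<alpha> D x =
     {y \<in> space MY. ereal (fitted_score S K0 D (x, y)) \<le> hcp2_threshold S K0 K \<alpha> D}"

text \<open>The test pair is independent of the data, so given the data and \<open>X = x\<close> its response
  is distributed according to \<open>PY x\<close>.\<close>

definition cond_miscoverage ::
  "'y measure \<Rightarrow> ('x \<Rightarrow> 'y measure) \<Rightarrow> ((nat \<Rightarrow> ('x, 'y) grp) \<Rightarrow> 'x \<times> 'y \<Rightarrow> real)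
    \<Rightarrow> nat \<Rightarrow> nat \<Rightarrow> real \<Rightarrow> (nat \<Rightarrow> ('x, 'y) grp) \<Rightarrow> 'x \<Rightarrow> real" where
  "cond_miscoverage MY PY S K0 K \<alpha> D x = \<P>(y in PY x. y \<notin> hcp2_set MY S K0 K \<alpha> D x)"

definition all_scores_distinct ::
  "((nat \<Rightarrow> ('x, 'y) grp) \<Rightarrow> 'x \<times> 'y \<Rightarrow> real) \<Rightarrow> nat \<Rightarrow> nat \<Rightarrow> (nat \<Rightarrow> ('x, 'y) grp) \<Rightarrow> bool" where
  "all_scores_distinct S K0 L D \<longleftrightarrow>
     inj_on (\<lambda>(k, i). fitted_score S K0 D (obs (D k) i))
       (SIGMA k:{K0+1..L}. {1..grp_size (D k)})"

end

theory Submission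
  imports Defs
begin

text \<open>The prediction set thresholds the scores at a single level \<open>T\<close>, and the square of the
  conditional miscoverage at \<open>x\<close> is the probability that two independent responses at \<open>x\<close> both
  have a score above \<open>T\<close>. A group with at least two measurements carries such pairs: given its
  covariate and its size, the fraction \<open>h(t)\<close> of its pairs in which both scores exceed \<open>t\<close> has
  exactly this probability as its expectation (\<open>expectation_pair_exceed\<close>). Hence \<open>p\<close>, the probability of
  at least two measurements, times the expected squared miscoverage under the reweighted covariate
  law is the expectation of \<open>h(T)\<close> for a fresh group, where \<open>h\<close> vanishes on groups with fewer than
  two measurements (\<open>nn_integral_pair_exceed\<close>).

  The weights \<open>(N - i) / (N choose 2)\<close> are the law of the smaller score in a random pair: the
  \<open>i\<close>-th order statistic is the minimum of exactly \<open>N - i\<close> pairs. So \<open>T\<close> is determined by the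
  functions \<open>F\<^sub>k = 1 - h\<^sub>k\<close> of the calibration groups with at least two measurements: it is the
  least \<open>t\<close> at which their sum reaches \<open>(1 - \<alpha>\<^sup>2) n\<close>, where \<open>n\<close> is the number of these
  groups plus one (\<open>hcp2_threshold_eq\<close>).

  Now pool the calibration groups with the test group. Given the training data they are
  exchangeable, so the test group may be replaced by any group \<open>k\<close> of the pool, with the threshold
  \<open>T\<^sub>k\<close> computed from the others (\<open>integral_loo_exceed_eq\<close>). Averaging over \<open>k\<close> reduces both
  bounds to deterministic statements about \<open>\<Sum>\<^sub>k h\<^sub>k(T\<^sub>k)\<close>, summed over the pool, where \<open>n\<close> is
  now the number of pool groups with at least two measurements and has expectation \<open>(K1 + 1) p\<close>.

  Upper bound (\<open>leave_one_out_exceed_le\<close>): leaving a group out only raises the threshold, so each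
  \<open>T\<^sub>k\<close> is at least the level \<open>v\<close> at which the sum of all \<open>F\<^sub>k\<close> reaches \<open>(1 - \<alpha>\<^sup>2) n\<close>, and
  \<open>\<Sum>\<^sub>k h\<^sub>k(v) \<le> \<alpha>\<^sup>2 n\<close>.

  Lower bound (\<open>leave_one_out_exceed_ge\<close>): a single \<open>F\<^sub>k\<close> is at most \<open>1\<close>, so each \<open>T\<^sub>k\<close> is at most
  the level \<open>v\<close> at which the sum of all \<open>F\<^sub>k\<close> reaches \<open>(1 - \<alpha>\<^sup>2) n + 1\<close>. If the scores are
  distinct, only one \<open>F\<^sub>k\<close> jumps at \<open>v\<close>, by at most \<open>1\<close>, so the sum at \<open>v\<close> is at most
  \<open>(1 - \<alpha>\<^sup>2) n + 2\<close> and \<open>\<Sum>\<^sub>k h\<^sub>k(v) \<ge> \<alpha>\<^sup>2 n - 2\<close>. The two units lost here are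
  the numerator of the correction term.\<close>

section \<open>Pairs of scores and the prediction threshold\<close>

definition exceed_count :: "('x \<times> 'y \<Rightarrow> real) \<Rightarrow> ereal \<Rightarrow> ('x, 'y) grp \<Rightarrow> nat" where
  "exceed_count s t g = card {i \<in> {1..grp_size g}. t < ereal (s (obs g i))}"

text \<open>The fraction of the pairs of measurements in which both scores exceed \<open>t\<close>. For fewer than two
  measurements the quotient is \<open>0 / 0 = 0\<close>, so such groups contribute nothing to sums and
  expectations.\<close>

definition pair_exceed :: "('x \<times> 'y \<Rightarrow> real) \<Rightarrow> ereal \<Rightarrow> ('x, 'y) grp \<Rightarrow> real" where
  "pair_exceed s t g = real (exceed_count s t g choose 2) / real (grp_size g choose 2)"

text \<open>The distribution function of the smaller score in a random pair. Groups without a pair get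
  the value \<open>0\<close>, so that sums may range over all groups.\<close>

definition pair_cdf :: "('x \<times> 'y \<Rightarrow> real) \<Rightarrow> real \<Rightarrow> ('x, 'y) grp \<Rightarrow> real" where
  "pair_cdf s t g = (if 2 \<le> grp_size g then 1 - pair_exceed s (ereal t) g else 0)"

definition big_groups :: "nat set \<Rightarrow> (nat \<Rightarrow> ('x, 'y) grp) \<Rightarrow> nat set" where
  "big_groups J D = {k \<in> J. 2 \<le> grp_size (D k)}"

text \<open>The quantile that defines the prediction set, for an arbitrary set \<open>J\<close> of calibration groups;
  the factor \<open>card (big_groups J D) + 1\<close> accounts for the atom at infinity.\<close>

definition pair_threshold ::
  "('x \<times> 'y \<Rightarrow> real) \<Rightarrow> real \<Rightarrow> nat set \<Rightarrow> (nat \<Rightarrow> ('x, 'y) grp) \<Rightarrow> ereal" where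
  "pair_threshold s \<beta> J D =
     Inf (ereal ` {t. \<beta> * (real (card (big_groups J D)) + 1) \<le> (\<Sum>k\<in>J. pair_cdf s t (D k))})"

lemma exceed_count_le: "exceed_count s t g \<le> grp_size g"
proof -
  have "exceed_count s t g \<le> card {1..grp_size g}"
    unfolding exceed_count_def by (intro card_mono) auto
  then show ?thesis by simp
qed

lemma exceed_count_antimono: "t \<le> u \<Longrightarrow> exceed_count s u g \<le> exceed_count s t g"
  unfolding exceed_count_def by (intro card_mono) (auto intro: le_less_trans)

lemma choose_two_mono: "a \<le> b \<Longrightarrow> a choose 2 \<le> b choose (2::nat)"
  unfolding choose_two by (intro div_le_mono mult_le_mono) auto

lemma pair_exceed_nonneg: "0 \<le> pair_exceed s t g"
  by (simp add: pair_exceed_def)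

lemma pair_exceed_le_one: "pair_exceed s t g \<le> 1"
proof -
  have "exceed_count s t g choose 2 \<le> grp_size g choose 2"
    by (intro choose_two_mono exceed_count_le)
  then show ?thesis by (auto simp: pair_exceed_def divide_le_eq_1)
qed

lemma pair_exceed_small: "grp_size g < 2 \<Longrightarrow> pair_exceed s t g = 0"
  by (simp add: pair_exceed_def binomial_eq_0)

lemma pair_exceed_antimono: "t \<le> u \<Longrightarrow> pair_exceed s u g \<le> pair_exceed s t g"
  unfolding pair_exceed_def
  by (intro divide_right_mono) (auto intro!: choose_two_mono exceed_count_antimono)

lemma pair_cdf_mono: "t \<le> u \<Longrightarrow> pair_cdf s t g \<le> pair_cdf s u g"
  by (simp add: pair_cdf_def pair_exceed_antimono)

lemma pair_cdf_bounds: "0 \<le> pair_cdf s t g" "pair_cdf s t g \<le> 1"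
  by (auto simp: pair_cdf_def pair_exceed_nonneg pair_exceed_le_one)

lemma pair_exceed_eq_cdf:
  "pair_exceed s (ereal t) g = (if 2 \<le> grp_size g then 1 else 0) - pair_cdf s t g"
  by (simp add: pair_cdf_def pair_exceed_small)

lemma sum_pair_exceed:
  assumes "finite J"
  shows "(\<Sum>k\<in>J. pair_exceed s (ereal t) (D k))
           = real (card (big_groups J D)) - (\<Sum>k\<in>J. pair_cdf s t (D k))"
proof -
  have "(\<Sum>k\<in>J. if 2 \<le> grp_size (D k) then 1 else 0::real) = real (card (big_groups J D))"
    using assms by (simp add: big_groups_def sum.If_cases Int_def)
  then show ?thesis by (simp add: pair_exceed_eq_cdf sum_subtractf)
qed

text \<open>The positions of a sorted list with entries at most \<open>t\<close> are closed downwards, hence an initial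
  segment of the positions.\<close>

lemma sorted_nth_le_iff:
  fixes xs :: "real list"
  assumes "sorted xs" "i < length xs"
  shows "xs ! i \<le> t \<longleftrightarrow> i < length (filter (\<lambda>x. x \<le> t) xs)"
proof -
  define A where "A = {i. i < length xs \<and> xs ! i \<le> t}"
  have down: "j \<in> A" if "i \<in> A" "j \<le> i" for i j
    using that sorted_nth_mono[OF assms(1), of j i] unfolding A_def by auto
  have fin: "finite A" unfolding A_def by auto
  have "A = {..<card A}"
  proof (cases "A = {}")
    case False
    have "A = {..Max A}" using down[OF Max_in[OF fin False]] Max_ge[OF fin] by auto
    then show ?thesis by (metis card_atMost lessThan_Suc_atMost)
  qed simp
  then have "i \<in> A \<longleftrightarrow> i < card A" by blast
  then show ?thesis using assms(2) by (simp add: A_def length_filter_conv_card)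
qed

text \<open>Choosing a two-element subset of \<open>{1..N}\<close> by its smaller element \<open>i\<close> leaves \<open>N - i\<close> options;
  the subsets whose smaller element exceeds \<open>m\<close> are the pairs from the remaining \<open>N - m\<close> elements.\<close>

lemma sum_descending_eq_choose:
  "m \<le> N \<Longrightarrow> (\<Sum>i=1..m. real (N - i)) = real (N choose 2) - real ((N - m) choose 2)"
proof (induction m)
  case (Suc m)
  have "(N - m) choose 2 = (N - Suc m) + ((N - Suc m) choose 2)"
    using Suc.prems binomial_Suc_Suc[of "N - Suc m" 1] by (simp add: numeral_2_eq_2 Suc_diff_Suc)
  then show ?case using Suc by simp
qed simp

lemma length_filter_scores:
  "length (filter (\<lambda>x. x \<le> t) (map (\<lambda>j. s (obs g j)) [1..<Suc (grp_size g)]))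
     = grp_size g - exceed_count s (ereal t) g"
proof -
  let ?N = "grp_size g"
  have "length (filter (\<lambda>x. x \<le> t) (map (\<lambda>j. s (obs g j)) [1..<Suc ?N]))
      = length (filter (\<lambda>j. s (obs g j) \<le> t) [1..<Suc ?N])"
    by (simp add: filter_map o_def del: upt_Suc)
  also have "\<dots> = card (set (filter (\<lambda>j. s (obs g j) \<le> t) [1..<Suc ?N]))"
    by (rule distinct_card[symmetric]) simp
  also have "set (filter (\<lambda>j. s (obs g j) \<le> t) [1..<Suc ?N])
      = {1..?N} - {i \<in> {1..?N}. ereal t < ereal (s (obs g i))}"
    by auto
  also have "card \<dots> = ?N - exceed_count s (ereal t) g"
    unfolding exceed_count_def by (subst card_Diff_subset) auto
  finally show ?thesis .
qed

text \<open>A pair has its smaller score above \<open>t\<close> exactly if both of its scores are above \<open>t\<close>, and the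
  order statistics up to \<open>t\<close> are the first \<open>N - c\<close> ones, where \<open>c\<close> scores exceed \<open>t\<close>.\<close>

lemma sum_order_stat_weights:
  assumes "2 \<le> grp_size g"
  shows "(\<Sum>i=1..grp_size g.
            if order_stat s g i \<le> t then real (grp_size g - i) / real (grp_size g choose 2) else 0)
         = pair_cdf s t g"
proof -
  let ?N = "grp_size g" and ?c = "exceed_count s (ereal t) g"
  let ?xs = "sort (map (\<lambda>j. s (obs g j)) [1..<Suc ?N])"
  have pos: "0 < ?N choose 2" using assms by simp
  have le: "?c \<le> ?N" by (rule exceed_count_le)
  have len: "length (filter (\<lambda>x. x \<le> t) ?xs) = ?N - ?c"
    using length_filter_scores[of t s g] by (simp add: filter_sort del: upt_Suc)
  have iff: "order_stat s g i \<le> t \<longleftrightarrow> i \<le> ?N - ?c" if "i \<in> {1..?N}" for i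
  proof -
    have "i - 1 < length ?xs" using that by (auto simp del: upt_Suc)
    then have "?xs ! (i - 1) \<le> t \<longleftrightarrow> i - 1 < ?N - ?c"
      by (subst sorted_nth_le_iff) (simp_all only: sorted_sort len)
    then show ?thesis using that unfolding order_stat_def by auto
  qed
  have "(\<Sum>i=1..?N. if order_stat s g i \<le> t then real (?N - i) / real (?N choose 2) else 0)
      = (\<Sum>i\<in>{1..?N}. if i \<in> {1..?N - ?c} then real (?N - i) / real (?N choose 2) else 0)"
    by (intro sum.cong refl) (auto simp: iff)
  also have "\<dots> = (\<Sum>i=1..?N - ?c. real (?N - i) / real (?N choose 2))"
    by (subst sum.inter_restrict[symmetric]) (auto intro: sum.cong)
  also have "\<dots> = (real (?N choose 2) - real (?c choose 2)) / real (?N choose 2)"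
    using sum_descending_eq_choose[of "?N - ?c" ?N] le by (simp flip: sum_divide_distrib)
  also have "\<dots> = pair_cdf s t g"
    using pos assms by (simp add: pair_cdf_def pair_exceed_def diff_divide_distrib)
  finally show ?thesis .
qed

lemma measure_weighted_atoms:
  assumes "finite I" "\<And>j. j \<in> I \<Longrightarrow> 0 \<le> w j" "A \<in> sets borel"
  shows "measure (weighted_atoms I w v) A = (\<Sum>j\<in>I. if v j \<in> A then w j else 0)"
proof -
  have "measure (weighted_atoms I w v) A
      = measure (point_measure I (\<lambda>j. ennreal (w j))) (v -` A \<inter> I)"
    unfolding weighted_atoms_def using assms
    by (subst measure_distr) (auto simp: space_point_measure measurable_def sets_point_measure)
  also have "\<dots> = (\<Sum>j\<in>v -` A \<inter> I. w j)"
    using assms by (subst measure_point_measure_finite_if) auto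
  also have "\<dots> = (\<Sum>j\<in>I. if v j \<in> A then w j else 0)"
    using assms by (simp add: sum.If_cases Int_commute vimage_def)
  finally show ?thesis .
qed

lemma hcp2_measure_Iic:
  "measure (hcp2_measure s K0 K D) {u \<in> space (hcp2_measure s K0 K D). u \<le> ereal t}
     = (\<Sum>k\<in>{K0+1..K}. pair_cdf s t (D k)) / (real (card (big_groups {K0+1..K} D)) + 1)"
proof -
  define G where "G = big_groups {K0+1..K} D"
  have G: "cal_groups K0 K D = G" unfolding cal_groups_def big_groups_def G_def ..
  define m where "m = real (card G)"
  have fin: "finite G" unfolding G_def big_groups_def by simp
  let ?P = "SIGMA k:G. {1..grp_size (D k)}"
  define w where "w = (\<lambda>j. case j of None \<Rightarrow> 1 / (m + 1)
        | Some (k, i) \<Rightarrow> real (grp_size (D k) - i) / ((m + 1) * real (grp_size (D k) choose 2)))"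
  define v where "v = (\<lambda>j. case j of None \<Rightarrow> \<infinity> | Some (k, i) \<Rightarrow> ereal (order_stat s (D k) i))"
  have eq: "hcp2_measure s K0 K D = weighted_atoms (insert None (Some ` ?P)) w v"
    unfolding hcp2_measure_def Let_def G m_def[symmetric] w_def v_def ..
  have sp: "space (hcp2_measure s K0 K D) = UNIV" by (simp add: eq weighted_atoms_def)
  have "measure (hcp2_measure s K0 K D) {u \<in> space (hcp2_measure s K0 K D). u \<le> ereal t}
      = (\<Sum>j\<in>insert None (Some ` ?P). if v j \<in> {u. u \<le> ereal t} then w j else 0)"
    unfolding sp unfolding eq using fin
    by (subst measure_weighted_atoms) (auto simp: w_def m_def split: option.split)
  also have "\<dots> = (\<Sum>j\<in>Some ` ?P. if v j \<in> {u. u \<le> ereal t} then w j else 0)"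
    using fin by (subst sum.insert) (auto simp: v_def)
  also have "\<dots> = (\<Sum>(k,i)\<in>?P. if order_stat s (D k) i \<le> t
      then real (grp_size (D k) - i) / ((m + 1) * real (grp_size (D k) choose 2)) else 0)"
    by (subst sum.reindex) (auto simp: v_def w_def intro!: sum.cong)
  also have "\<dots> = (\<Sum>k\<in>G. \<Sum>i=1..grp_size (D k). if order_stat s (D k) i \<le> t
      then real (grp_size (D k) - i) / ((m + 1) * real (grp_size (D k) choose 2)) else 0)"
    using fin by (subst sum.Sigma) auto
  also have "\<dots> = (\<Sum>k\<in>G. (\<Sum>i=1..grp_size (D k). if order_stat s (D k) i \<le> t
      then real (grp_size (D k) - i) / real (grp_size (D k) choose 2) else 0) / (m + 1))"
    unfolding sum_divide_distrib by (intro sum.cong refl) (auto simp: field_simps)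
  also have "\<dots> = (\<Sum>k\<in>G. pair_cdf s t (D k) / (m + 1))"
    by (intro sum.cong refl arg_cong2[where f="(/)"] sum_order_stat_weights)
      (auto simp: G_def big_groups_def)
  also have "\<dots> = (\<Sum>k\<in>{K0+1..K}. pair_cdf s t (D k)) / (m + 1)"
    unfolding sum_divide_distrib
    by (rule sum.mono_neutral_left) (auto simp: G_def big_groups_def pair_cdf_def)
  finally show ?thesis by (simp add: m_def G_def)
qed

text \<open>Multiplying the quantile condition by the total number of groups removes all reference to
  order statistics and measures.\<close>

lemma hcp2_threshold_eq:
  "hcp2_threshold S K0 K \<alpha> D = pair_threshold (fitted_score S K0 D) (1 - \<alpha>\<^sup>2) {K0+1..K} D"
proof -
  have "0 < real (card (big_groups {K0+1..K} D)) + 1" by simp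
  then show ?thesis
    unfolding hcp2_threshold_def quantile_def pair_threshold_def hcp2_measure_Iic
    by (simp add: pos_le_divide_eq)
qed

section \<open>Leave-one-out thresholds\<close>

definition score_values :: "('x \<times> 'y \<Rightarrow> real) \<Rightarrow> ('x, 'y) grp \<Rightarrow> real set" where
  "score_values s g = (\<lambda>i. s (obs g i)) ` {1..grp_size g}"

lemma finite_score_values: "finite (score_values s g)"
  by (simp add: score_values_def)

lemma pair_cdf_no_jump:
  assumes "t \<le> u" "score_values s g \<inter> {t<..u} = {}"
  shows "pair_cdf s t g = pair_cdf s u g"
proof -
  have "{i \<in> {1..grp_size g}. ereal t < ereal (s (obs g i))}
      = {i \<in> {1..grp_size g}. ereal u < ereal (s (obs g i))}"
    using assms by (fastforce simp: score_values_def)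
  then show ?thesis by (simp add: pair_cdf_def pair_exceed_def exceed_count_def)
qed

lemma pair_cdf_eq_0:
  assumes "score_values s g \<inter> {..t} = {}"
  shows "pair_cdf s t g = 0"
proof -
  have "{i \<in> {1..grp_size g}. ereal t < ereal (s (obs g i))} = {1..grp_size g}"
    using assms by (auto simp: score_values_def)
  then have "exceed_count s (ereal t) g = grp_size g"
    by (simp add: exceed_count_def)
  then show ?thesis by (simp add: pair_cdf_def pair_exceed_def)
qed

lemma pair_cdf_eq_1:
  assumes "score_values s g \<subseteq> {..t}" "2 \<le> grp_size g"
  shows "pair_cdf s t g = 1"
proof -
  have "{i \<in> {1..grp_size g}. ereal t < ereal (s (obs g i))} = {}"
    using assms by (force simp: score_values_def)
  then have "exceed_count s (ereal t) g = 0"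
    by (simp add: exceed_count_def)
  then show ?thesis using assms by (simp add: pair_cdf_def pair_exceed_def)
qed

text \<open>A step function that jumps only at the points of a finite set \<open>V\<close> attains every positive level
  first at a point of \<open>V\<close>: below any argument where the level is reached lies a largest point of
  \<open>V\<close>, and the function is constant in between.\<close>

lemma step_function_least_level:
  fixes \<Phi> :: "real \<Rightarrow> real"
  assumes "finite V"
    and const: "\<And>t u. t \<le> u \<Longrightarrow> V \<inter> {t<..u} = {} \<Longrightarrow> \<Phi> t = \<Phi> u"
    and zero: "\<And>t. V \<inter> {..t} = {} \<Longrightarrow> \<Phi> t = 0"
    and "0 < c" "c \<le> \<Phi> a"
  obtains v where "v \<in> V" "c \<le> \<Phi> v" "\<And>t. c \<le> \<Phi> t \<Longrightarrow> v \<le> t"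
proof -
  have ex: "\<exists>v\<in>V. v \<le> t \<and> c \<le> \<Phi> v" if "c \<le> \<Phi> t" for t
  proof -
    have ne: "V \<inter> {..t} \<noteq> {}" using zero[of t] that \<open>0 < c\<close> by auto
    define v where "v = Max (V \<inter> {..t})"
    have fin: "finite (V \<inter> {..t})" using assms(1) by simp
    have v: "v \<in> V" "v \<le> t" using Max_in[OF fin ne] by (auto simp: v_def)
    moreover have "V \<inter> {v<..t} = {}"
      using Max_ge[OF fin] by (fastforce simp: v_def[symmetric])
    ultimately show ?thesis using const[of v t] that by auto
  qed
  define W where "W = {v \<in> V. c \<le> \<Phi> v}"
  have W: "finite W" "W \<noteq> {}" using assms(1) ex[OF assms(5)] by (auto simp: W_def)
  show ?thesis
  proof (rule that[of "Min W"])
    show "Min W \<in> V" "c \<le> \<Phi> (Min W)" using Min_in[OF W] by (auto simp: W_def)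
    fix t assume "c \<le> \<Phi> t"
    from ex[OF this] obtain v where "v \<in> W" "v \<le> t" by (auto simp: W_def)
    then show "Min W \<le> t" using Min_le[OF W(1)] by force
  qed
qed

lemma least_pooled_level:
  assumes "finite I" "0 < c" "c \<le> real (card (big_groups I D))"
  obtains v where "\<exists>k\<in>I. v \<in> score_values s (D k)" "c \<le> (\<Sum>k\<in>I. pair_cdf s v (D k))"
    "\<And>t. c \<le> (\<Sum>k\<in>I. pair_cdf s t (D k)) \<Longrightarrow> v \<le> t"
proof -
  define V where "V = (\<Union>k\<in>I. score_values s (D k))"
  have fin: "finite V" using assms(1) by (auto simp: V_def finite_score_values)
  \<comment> \<open>Above all scores every group with a pair has distribution function 1.\<close>
  define a where "a = Max (insert 0 V)"
  have a: "score_values s (D k) \<subseteq> {..a}" if "k \<in> I" for k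
    using that fin unfolding a_def by (auto intro!: Max_ge simp: V_def finite_score_values)
  have "(\<Sum>k\<in>I. pair_cdf s a (D k)) = (\<Sum>k\<in>I. if 2 \<le> grp_size (D k) then 1 else 0)"
  proof (intro sum.cong refl)
    show "pair_cdf s a (D k) = (if 2 \<le> grp_size (D k) then 1 else 0)" if "k \<in> I" for k
      using pair_cdf_eq_1[OF a[OF that]] by (simp add: pair_cdf_def)
  qed
  also have "\<dots> = real (card (big_groups I D))"
    using assms(1) by (simp add: big_groups_def sum.If_cases Int_def)
  finally have top: "c \<le> (\<Sum>k\<in>I. pair_cdf s a (D k))" using assms(3) by simp
  note pooled = that
  show ?thesis
  proof (rule step_function_least_level[OF fin, of "\<lambda>t. \<Sum>k\<in>I. pair_cdf s t (D k)" c a])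
    show "(\<Sum>k\<in>I. pair_cdf s t (D k)) = (\<Sum>k\<in>I. pair_cdf s u (D k))"
      if "t \<le> u" "V \<inter> {t<..u} = {}" for t u
      using that by (intro sum.cong refl pair_cdf_no_jump) (auto simp: V_def)
    show "(\<Sum>k\<in>I. pair_cdf s t (D k)) = 0" if "V \<inter> {..t} = {}" for t
      using that by (intro sum.neutral ballI pair_cdf_eq_0) (auto simp: V_def)
    show thesis if "v \<in> V" "c \<le> (\<Sum>k\<in>I. pair_cdf s v (D k))"
      "\<And>t. c \<le> (\<Sum>k\<in>I. pair_cdf s t (D k)) \<Longrightarrow> v \<le> t" for v
      using that(1) by (intro pooled[of v] that(2,3)) (auto simp: V_def)
  qed (use assms top in auto)
qed

lemma card_big_groups_remove:
  assumes "finite I" "k \<in> big_groups I D"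
  shows "real (card (big_groups (I - {k}) D)) + 1 = real (card (big_groups I D))"
proof -
  have "big_groups (I - {k}) D = big_groups I D - {k}" by (auto simp: big_groups_def)
  moreover have "finite (big_groups I D)" using assms(1) by (simp add: big_groups_def)
  ultimately show ?thesis using assms(2) by (metis Suc_eq_plus1 add.commute card_Suc_Diff1 of_nat_Suc)
qed

text \<open>Removing a group lowers the sum of the distribution functions but not the level
  \<open>\<beta> n\<close> to be reached, because the atom at infinity replaces the removed group in the count. So
  every leave-one-out threshold is at least the pooled quantile \<open>v\<close>, which does not depend on \<open>k\<close>.\<close>

lemma leave_one_out_exceed_le:
  assumes "finite I" "0 < \<beta>" "\<beta> < 1"
  shows "(\<Sum>k\<in>I. pair_exceed s (pair_threshold s \<beta> (I - {k}) D) (D k))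
           \<le> (1 - \<beta>) * real (card (big_groups I D))"
proof (cases "big_groups I D = {}")
  case True
  then have "pair_exceed s t (D k) = 0" if "k \<in> I" for k t
    using that by (intro pair_exceed_small) (auto simp: big_groups_def not_le)
  then show ?thesis using True by simp
next
  case False
  define n where "n = real (card (big_groups I D))"
  have "finite (big_groups I D)" using assms(1) by (simp add: big_groups_def)
  with False have "0 < n" by (simp add: n_def card_gt_0_iff)
  then have "0 < \<beta> * n" "\<beta> * n \<le> n" using assms by simp_all
  with least_pooled_level[OF assms(1), of "\<beta> * n" D s] obtain v
    where v: "\<beta> * n \<le> (\<Sum>k\<in>I. pair_cdf s v (D k))"
      "\<And>t. \<beta> * n \<le> (\<Sum>k\<in>I. pair_cdf s t (D k)) \<Longrightarrow> v \<le> t"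
    unfolding n_def by metis
  have "pair_exceed s (pair_threshold s \<beta> (I - {k}) D) (D k) \<le> pair_exceed s (ereal v) (D k)"
    if "k \<in> I" for k
  proof (cases "k \<in> big_groups I D")
    case True
    have "ereal v \<le> pair_threshold s \<beta> (I - {k}) D"
      unfolding pair_threshold_def card_big_groups_remove[OF assms(1) True]
    proof (intro Inf_greatest, safe)
      fix t assume "\<beta> * real (card (big_groups I D)) \<le> (\<Sum>k\<in>I - {k}. pair_cdf s t (D k))"
      also have "\<dots> \<le> (\<Sum>k\<in>I. pair_cdf s t (D k))"
        using assms(1) by (intro sum_mono2) (auto simp: pair_cdf_bounds)
      finally show "ereal v \<le> ereal t" using v(2) by (simp add: n_def)
    qed
    then show ?thesis by (rule pair_exceed_antimono)
  next
    case False
    then show ?thesis using that by (simp add: big_groups_def pair_exceed_small)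
  qed
  then have "(\<Sum>k\<in>I. pair_exceed s (pair_threshold s \<beta> (I - {k}) D) (D k))
      \<le> (\<Sum>k\<in>I. pair_exceed s (ereal v) (D k))"
    by (rule sum_mono)
  also have "\<dots> = n - (\<Sum>k\<in>I. pair_cdf s v (D k))"
    unfolding n_def by (rule sum_pair_exceed[OF assms(1)])
  also have "\<dots> \<le> (1 - \<beta>) * n" using v(1) by (simp add: algebra_simps)
  finally show ?thesis by (simp add: n_def)
qed

text \<open>The threshold without group \<open>k\<close> is at most the point \<open>v\<close> where the pooled sum first reaches
  \<open>\<beta> n + 1\<close>, since removing the group costs at most one unit. Just below \<open>v\<close> the sum is less than
  \<open>\<beta> n + 1\<close>, and distinctness of the scores allows only one group to jump at \<open>v\<close>, which
  costs at most one more unit. If \<open>\<beta> n + 1 > n\<close> the point \<open>v\<close> need not exist, but then the lower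
  bound is negative.\<close>

lemma leave_one_out_exceed_ge:
  assumes "finite I" "0 < \<beta>"
    and distinct: "inj_on (\<lambda>(k, i). s (obs (D k) i)) (SIGMA k:I. {1..grp_size (D k)})"
  shows "(1 - \<beta>) * real (card (big_groups I D)) - 2
           \<le> (\<Sum>k\<in>I. pair_exceed s (pair_threshold s \<beta> (I - {k}) D) (D k))"
proof -
  define n where "n = real (card (big_groups I D))"
  show ?thesis
  proof (cases "\<beta> * n + 1 \<le> n")
    case False
    have "0 \<le> (\<Sum>k\<in>I. pair_exceed s (pair_threshold s \<beta> (I - {k}) D) (D k))"
      by (intro sum_nonneg pair_exceed_nonneg)
    then show ?thesis using False by (simp add: n_def algebra_simps)
  next
    case True
    have "0 < \<beta> * n + 1" using assms(2) by (simp add: n_def add_nonneg_pos)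
    with True least_pooled_level[OF assms(1), of "\<beta> * n + 1" D s] obtain v
      where ex: "\<exists>k\<in>I. v \<in> score_values s (D k)"
        and v: "\<beta> * n + 1 \<le> (\<Sum>k\<in>I. pair_cdf s v (D k))"
        "\<And>t. \<beta> * n + 1 \<le> (\<Sum>k\<in>I. pair_cdf s t (D k)) \<Longrightarrow> v \<le> t"
      unfolding n_def by metis
    have le: "pair_exceed s (ereal v) (D k) \<le> pair_exceed s (pair_threshold s \<beta> (I - {k}) D) (D k)"
      if "k \<in> I" for k
    proof (cases "k \<in> big_groups I D")
      case big: True
      have "\<beta> * n + 1 \<le> pair_cdf s v (D k) + (\<Sum>k\<in>I - {k}. pair_cdf s v (D k))"
        using v(1) that assms(1) by (simp add: sum.remove)
      also have "\<dots> \<le> 1 + (\<Sum>k\<in>I - {k}. pair_cdf s v (D k))"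
        by (simp add: pair_cdf_bounds)
      finally have "pair_threshold s \<beta> (I - {k}) D \<le> ereal v"
        unfolding pair_threshold_def card_big_groups_remove[OF assms(1) big]
        by (intro Inf_lower) (simp add: n_def)
      then show ?thesis by (rule pair_exceed_antimono)
    next
      case False
      then show ?thesis using that by (simp add: big_groups_def pair_exceed_small)
    qed
    \<comment> \<open>The point \<open>t\<close> lies below \<open>v\<close> with no score strictly in between, so the sum at \<open>t\<close> is its
      left limit at \<open>v\<close>; the element \<open>v - 1\<close> covers the case of no score below \<open>v\<close>.\<close>
    define V where "V = (\<Union>k\<in>I. score_values s (D k))"
    have finV: "finite V" using assms(1) by (auto simp: V_def finite_score_values)
    define t where "t = Max (insert (v - 1) (V \<inter> {..<v}))"
    have "t \<in> insert (v - 1) (V \<inter> {..<v})" unfolding t_def using finV by (intro Max_in) auto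
    then have tv: "t < v" by auto
    have gap: "w \<le> t" if "w \<in> V" "w < v" for w
      unfolding t_def using that finV by (intro Max_ge) auto
    from ex obtain k0 where k0: "k0 \<in> I" "v \<in> score_values s (D k0)" by blast
    have "pair_cdf s t (D k) = pair_cdf s v (D k)" if "k \<in> I - {k0}" for k
    proof (rule pair_cdf_no_jump)
      have "v \<notin> score_values s (D k)"
      proof
        assume "v \<in> score_values s (D k)"
        then obtain i where i: "i \<in> {1..grp_size (D k)}" "v = s (obs (D k) i)"
          by (auto simp: score_values_def)
        from k0 obtain i0 where i0: "i0 \<in> {1..grp_size (D k0)}" "v = s (obs (D k0) i0)"
          by (auto simp: score_values_def)
        show False using inj_onD[OF distinct, of "(k, i)" "(k0, i0)"] i i0 k0 that by auto
      qed
      then show "score_values s (D k) \<inter> {t<..v} = {}"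
        using gap that unfolding V_def by (force simp: less_le)
    qed (use tv in simp)
    then have "(\<Sum>k\<in>I. pair_cdf s v (D k)) - (\<Sum>k\<in>I. pair_cdf s t (D k))
        = pair_cdf s v (D k0) - pair_cdf s t (D k0)"
      using assms(1) k0(1) by (simp add: sum.remove)
    also have "\<dots> \<le> 1" using pair_cdf_bounds[of s v "D k0"] pair_cdf_bounds[of s t "D k0"] by simp
    finally have "(\<Sum>k\<in>I. pair_cdf s v (D k)) \<le> \<beta> * n + 2"
      using v(2)[of t] tv by force
    then have "(1 - \<beta>) * n - 2 \<le> (\<Sum>k\<in>I. pair_exceed s (ereal v) (D k))"
      unfolding sum_pair_exceed[OF assms(1)] by (simp add: n_def algebra_simps)
    also have "\<dots> \<le> (\<Sum>k\<in>I. pair_exceed s (pair_threshold s \<beta> (I - {k}) D) (D k))"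
      by (intro sum_mono le)
    finally show ?thesis by (simp add: n_def)
  qed
qed

section \<open>Measurability on spaces of lists\<close>

lemma mem_listset_iff: "xs \<in> listset As \<longleftrightarrow> list_all2 (\<in>) xs As"
proof (induction As arbitrary: xs)
  case (Cons A As)
  then show ?case by (cases xs) (auto simp: set_Cons_def)
qed simp

lemma listset_sets_subset:
  "{listset As |As. As \<in> lists (sets M)} \<subseteq> Pow (lists (space M))"
proof -
  have "x \<in> space M" if As: "As \<in> lists (sets M)" and xs: "xs \<in> listset As" and x: "x \<in> set xs"
    for As xs x
  proof -
    from x obtain i where "i < length xs" "x = xs ! i" by (auto simp: in_set_conv_nth)
    with xs have "x \<in> As ! i" "As ! i \<in> set As"
      by (auto simp: mem_listset_iff list_all2_conv_all_nth)
    with As show ?thesis using sets.sets_into_space by blast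
  qed
  then show ?thesis by blast
qed

lemma space_list_space: "space (list_space M) = lists (space M)"
  unfolding list_space_def using listset_sets_subset by (rule space_measure_of)

lemma sets_list_space:
  "sets (list_space M) = sigma_sets (lists (space M)) {listset As |As. As \<in> lists (sets M)}"
  unfolding list_space_def using listset_sets_subset by (rule sets_measure_of)

lemma listset_in_sets: "set As \<subseteq> sets M \<Longrightarrow> listset As \<in> sets (list_space M)"
  unfolding sets_list_space by (intro sigma_sets.Basic) auto

lemma list_space_cong:
  assumes "sets M = sets N" shows "list_space M = list_space N"
  unfolding list_space_def using assms sets_eq_imp_space_eq[OF assms] by simp

lemma listset_replicate_space:
  "listset (replicate n (space M)) = {xs \<in> space (list_space M). length xs = n}"
proof -
  have "(\<forall>x\<in>set xs. x \<in> space M) \<longleftrightarrow> (\<forall>i<length xs. xs ! i \<in> space M)" for xs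
    by (rule all_set_conv_all_nth)
  then show ?thesis by (auto simp: mem_listset_iff list_all2_conv_all_nth space_list_space in_lists_conv_set simp del: in_listsI)
qed

lemma measurable_length_list_space [measurable]:
  "length \<in> list_space M \<rightarrow>\<^sub>M count_space UNIV"
proof -
  have "length -` {n} \<inter> space (list_space M) \<in> sets (list_space M)" for n
  proof -
    have "length -` {n} \<inter> space (list_space M) = listset (replicate n (space M))"
      unfolding listset_replicate_space by auto
    then show ?thesis using listset_in_sets[of "replicate n (space M)" M]
      by (simp add: set_replicate_conv_if)
  qed
  then show ?thesis by (subst measurable_count_space_eq_countable) auto
qed

text \<open>Access to a list entry is partial; a default value in the space makes it a total measurable
  function.\<close>

definition nth_or :: "'a \<Rightarrow> nat \<Rightarrow> 'a list \<Rightarrow> 'a" where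
  "nth_or d i xs = (if i < length xs then xs ! i else d)"

lemma measurable_nth_or:
  assumes "d \<in> space M"
  shows "nth_or d i \<in> list_space M \<rightarrow>\<^sub>M M"
proof (rule measurableI)
  show "nth_or d i xs \<in> space M" if "xs \<in> space (list_space M)" for xs
    using that assms by (auto simp: nth_or_def space_list_space)
  fix A assume A: "A \<in> sets M"
  have slot: "{xs \<in> space (list_space M). length xs = n \<and> xs ! i \<in> A}
      = listset ((replicate n (space M))[i := A])" if "i < n" for n
  proof (rule set_eqI)
    fix xs
    have upd: "(replicate n (space M))[i := A] ! j = (if j = i then A else space M)" if "j < n" for j
      using that \<open>i < n\<close> by (simp add: nth_list_update)
    have "xs \<in> listset ((replicate n (space M))[i := A])
      \<longleftrightarrow> length xs = n \<and> (\<forall>j<n. xs ! j \<in> (if j = i then A else space M))"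
      using upd by (auto simp: mem_listset_iff list_all2_conv_all_nth)
    also have "\<dots> \<longleftrightarrow> length xs = n \<and> (\<forall>j<n. xs ! j \<in> space M) \<and> xs ! i \<in> A"
      using that sets.sets_into_space[OF A] by (metis subsetD)
    also have "\<dots> \<longleftrightarrow> xs \<in> {xs \<in> space (list_space M). length xs = n \<and> xs ! i \<in> A}"
      using all_set_conv_all_nth[of xs "\<lambda>x. x \<in> space M"]
      by (auto simp: space_list_space in_lists_conv_set simp del: in_listsI)
    finally show "xs \<in> {xs \<in> space (list_space M). length xs = n \<and> xs ! i \<in> A}
      \<longleftrightarrow> xs \<in> listset ((replicate n (space M))[i := A])" ..
  qed
  have 1: "{xs \<in> space (list_space M). length xs = n \<and> nth_or d i xs \<in> A} \<in> sets (list_space M)" for n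
  proof (cases "i < n")
    case True
    then have "{xs \<in> space (list_space M). length xs = n \<and> nth_or d i xs \<in> A}
        = listset ((replicate n (space M))[i := A])"
      unfolding slot[OF True, symmetric] by (auto simp: nth_or_def)
    also have "\<dots> \<in> sets (list_space M)"
      using A set_update_subset_insert[of "replicate n (space M)" i A]
      by (intro listset_in_sets) (auto dest!: subsetD)
    finally show ?thesis .
  next
    case False
    then have "{xs \<in> space (list_space M). length xs = n \<and> nth_or d i xs \<in> A}
        = {xs \<in> space (list_space M). length xs = n \<and> d \<in> A}"
      by (auto simp: nth_or_def)
    then show ?thesis by simp
  qed
  have "nth_or d i -` A \<inter> space (list_space M)
      = (\<Union>n. {xs \<in> space (list_space M). length xs = n \<and> nth_or d i xs \<in> A})"
    by auto
  also have "\<dots> \<in> sets (list_space M)" using 1 by blast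
  finally show "nth_or d i -` A \<inter> space (list_space M) \<in> sets (list_space M)" .
qed

text \<open>In this form the count is a sum whose length is a measurable function of the group and whose
  summands are measurable.\<close>

lemma exceed_count_eq_sum:
  "exceed_count s t g
     = (\<Sum>i<grp_size g. if t < ereal (s (fst g, nth_or d i (snd g))) then 1 else 0)"
proof -
  have "{i \<in> {1..grp_size g}. t < ereal (s (obs g i))}
      = Suc ` {i \<in> {..<grp_size g}. t < ereal (s (fst g, nth_or d i (snd g)))}"
    (is "?A = Suc ` ?B")
  proof (intro set_eqI iffI)
    fix i assume "i \<in> ?A"
    then have "i = Suc (i - 1)" "i - 1 \<in> ?B" by (auto simp: obs_def nth_or_def)
    then show "i \<in> Suc ` ?B" by (rule image_eqI)
  qed (auto simp: obs_def nth_or_def)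
  then have "exceed_count s t g = card ?B"
    unfolding exceed_count_def by (simp add: card_image)
  also have "\<dots> = (\<Sum>i<grp_size g. if t < ereal (s (fst g, nth_or d i (snd g))) then 1 else 0)"
    by (simp add: sum.If_cases Int_def)
  finally show ?thesis .
qed

text \<open>The score function may depend on a parameter \<open>w\<close>. This covers a score function fitted to the
  data, with \<open>w\<close> the data, as well as a constant one.\<close>

locale measurable_scores =
  fixes MX :: "'x measure" and MY :: "'y measure" and W :: "'w measure"
    and s :: "'w \<Rightarrow> 'x \<times> 'y \<Rightarrow> real"
  assumes nonempty: "space MY \<noteq> {}"
    and score [measurable]: "(\<lambda>(w, z). s w z) \<in> borel_measurable (W \<Otimes>\<^sub>M (MX \<Otimes>\<^sub>M MY))"
begin

lemma measurable_grp_size: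
  assumes [measurable]: "G \<in> W \<rightarrow>\<^sub>M grp_space MX MY"
  shows "(\<lambda>w. grp_size (G w)) \<in> W \<rightarrow>\<^sub>M count_space UNIV"
  using assms unfolding grp_space_def by measurable

lemma measurable_exceed_count:
  assumes G: "G \<in> W \<rightarrow>\<^sub>M grp_space MX MY" and [measurable]: "T \<in> borel_measurable W"
  shows "(\<lambda>w. exceed_count (s w) (T w) (G w)) \<in> W \<rightarrow>\<^sub>M count_space UNIV"
proof -
  obtain d where d: "d \<in> space MY" using nonempty by auto
  note [measurable] = measurable_nth_or[OF d] G[unfolded grp_space_def] measurable_grp_size[OF G]
  have "(\<lambda>w. s w (fst (G w), nth_or d i (snd (G w)))) \<in> borel_measurable W" for i
    using measurable_compose[OF _ score, of "\<lambda>w. (w, fst (G w), nth_or d i (snd (G w)))" W] by simp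
  then have "(\<lambda>w. \<Sum>i<n. if T w < ereal (s w (fst (G w), nth_or d i (snd (G w)))) then 1 else 0)
      \<in> W \<rightarrow>\<^sub>M count_space (UNIV :: nat set)" for n
    by measurable
  then show ?thesis
    unfolding exceed_count_eq_sum[where d = d]
    by (rule measurable_compose_countable) (rule measurable_grp_size[OF G])
qed

lemma measurable_pair_exceed:
  assumes G: "G \<in> W \<rightarrow>\<^sub>M grp_space MX MY" and T: "T \<in> borel_measurable W"
  shows "(\<lambda>w. pair_exceed (s w) (T w) (G w)) \<in> borel_measurable W"
proof -
  note [measurable] = measurable_grp_size[OF G] measurable_exceed_count[OF G T]
  show ?thesis unfolding pair_exceed_def by measurable
qed

lemma measurable_pair_threshold:
  assumes fin: "finite J" and G: "\<And>k. k \<in> J \<Longrightarrow> (\<lambda>w. G w k) \<in> W \<rightarrow>\<^sub>M grp_space MX MY"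
  shows "(\<lambda>w. pair_threshold (s w) \<beta> J (G w)) \<in> borel_measurable W"
proof (rule borel_measurableI_less)
  fix y :: ereal
  note [measurable] = measurable_grp_size[OF G]
  define c where "c w = \<beta> * (real (card (big_groups J (G w))) + 1)" for w
  have "real (card (big_groups J (G w))) = (\<Sum>k\<in>J. if 2 \<le> grp_size (G w k) then 1 else 0)" for w
    using fin by (simp add: big_groups_def sum.If_cases Int_def)
  then have [measurable]: "c \<in> borel_measurable W"
    unfolding c_def by simp
  have [measurable]: "(\<lambda>w. pair_exceed (s w) (ereal q) (G w k)) \<in> borel_measurable W"
    if "k \<in> J" for k q
    using that by (intro measurable_pair_exceed G) auto
  have [measurable]: "(\<lambda>w. \<Sum>k\<in>J. pair_cdf (s w) q (G w k)) \<in> borel_measurable W" for q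
    unfolding pair_cdf_def by measurable
  \<comment> \<open>The cumulative weight is monotone in the level, so that rational levels suffice and the event
    is a countable union.\<close>
  have "pair_threshold (s w) \<beta> J (G w) < y
      \<longleftrightarrow> (\<exists>q\<in>{q::rat. ereal (real_of_rat q) < y}. c w \<le> (\<Sum>k\<in>J. pair_cdf (s w) (real_of_rat q) (G w k)))" for w
  proof -
    have "pair_threshold (s w) \<beta> J (G w) < y
      \<longleftrightarrow> (\<exists>t. ereal t < y \<and> c w \<le> (\<Sum>k\<in>J. pair_cdf (s w) t (G w k)))"
      unfolding pair_threshold_def c_def by (auto simp: Inf_less_iff)
    also have "\<dots> \<longleftrightarrow> (\<exists>q\<in>{q::rat. ereal (real_of_rat q) < y}. c w \<le> (\<Sum>k\<in>J. pair_cdf (s w) (real_of_rat q) (G w k)))"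
    proof
      assume "\<exists>t. ereal t < y \<and> c w \<le> (\<Sum>k\<in>J. pair_cdf (s w) t (G w k))"
      then obtain t where t: "ereal t < y" "c w \<le> (\<Sum>k\<in>J. pair_cdf (s w) t (G w k))" by blast
      from ereal_dense2[OF t(1)] obtain u where u: "ereal t < ereal u" "ereal u < y" by blast
      then obtain q where q: "t < real_of_rat q" "real_of_rat q < u"
        using of_rat_dense[of t u] by auto
      have "(\<Sum>k\<in>J. pair_cdf (s w) t (G w k)) \<le> (\<Sum>k\<in>J. pair_cdf (s w) (real_of_rat q) (G w k))"
        using q by (intro sum_mono pair_cdf_mono) simp
      moreover have "ereal (real_of_rat q) < y" using q u by (metis ereal_less(3) less_ereal.simps(1) order_less_trans)
      ultimately show "\<exists>q\<in>{q::rat. ereal (real_of_rat q) < y}. c w \<le> (\<Sum>k\<in>J. pair_cdf (s w) (real_of_rat q) (G w k))"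
        using t by auto
    qed auto
    finally show ?thesis .
  qed
  then show "{w \<in> space W. pair_threshold (s w) \<beta> J (G w) < y} \<in> sets W"
    by simp
qed

end

section \<open>Independent samples of fixed length\<close>

lemma measurable_iid_map:
  "(\<lambda>\<omega>. map \<omega> [1..<Suc n]) \<in> (\<Pi>\<^sub>M i\<in>{1..n}. P) \<rightarrow>\<^sub>M list_space P" (is "?f \<in> ?M \<rightarrow>\<^sub>M _")
  and vimage_iid_map:
  "\<And>As. set As \<subseteq> sets P \<Longrightarrow> (\<lambda>\<omega>. map \<omega> [1..<Suc n]) -` listset As \<inter> space (\<Pi>\<^sub>M i\<in>{1..n}. P)
     = (if length As = n then \<Pi>\<^sub>E i\<in>{1..n}. As ! (i - 1) else {})"
proof -
  show *: "?f -` listset As \<inter> space ?M = (if length As = n then \<Pi>\<^sub>E i\<in>{1..n}. As ! (i - 1) else {})"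
    if As: "set As \<subseteq> sets P" for As
  proof -
    have sub: "As ! (i - 1) \<subseteq> space P" if "i \<in> {1..n}" "length As = n" for i
      using that As by (intro sets.sets_into_space) (auto intro!: subsetD[OF As] nth_mem)
    have "(\<forall>i<n. \<omega> (Suc i) \<in> As ! i) \<longleftrightarrow> (\<forall>i\<in>{1..n}. \<omega> i \<in> As ! (i - 1))" for \<omega>
      unfolding image_Suc_lessThan[symmetric] by auto
    then have mem: "?f \<omega> \<in> listset As \<longleftrightarrow> length As = n \<and> (\<forall>i\<in>{1..n}. \<omega> i \<in> As ! (i - 1))" for \<omega>
      by (auto simp: mem_listset_iff list_all2_conv_all_nth simp del: upt_Suc)
    show ?thesis
    proof (cases "length As = n")
      case True
      have "?f -` listset As \<inter> space ?M
          = {\<omega> \<in> {1..n} \<rightarrow>\<^sub>E space P. \<forall>i\<in>{1..n}. \<omega> i \<in> As ! (i - 1)}"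
        unfolding vimage_def mem space_PiM using True by blast
      also have "\<dots> = (\<Pi>\<^sub>E i\<in>{1..n}. As ! (i - 1))"
      proof (rule set_eqI)
        show "\<omega> \<in> {\<omega> \<in> {1..n} \<rightarrow>\<^sub>E space P. \<forall>i\<in>{1..n}. \<omega> i \<in> As ! (i - 1)}
            \<longleftrightarrow> \<omega> \<in> (\<Pi>\<^sub>E i\<in>{1..n}. As ! (i - 1))" for \<omega>
          unfolding mem_Collect_eq PiE_iff using sub[OF _ True] by blast
      qed
      finally show ?thesis using True by simp
    next
      case False
      then show ?thesis unfolding vimage_def mem by simp
    qed
  qed
  show "?f \<in> ?M \<rightarrow>\<^sub>M list_space P"
    unfolding list_space_def
  proof (rule measurable_measure_of[OF listset_sets_subset])
    show "?f \<in> space ?M \<rightarrow> lists (space P)"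
      by (auto simp: space_PiM PiE_iff simp del: upt_Suc)
    fix A assume "A \<in> {listset As |As. As \<in> lists (sets P)}"
    then obtain As where As: "A = listset As" "set As \<subseteq> sets P" by auto
    have "(\<Pi>\<^sub>E i\<in>{1..n}. As ! (i - 1)) \<in> sets ?M" if "length As = n"
      using that As by (intro sets_PiM_I_finite) (auto intro!: subsetD[OF As(2)] nth_mem)
    then show "?f -` A \<inter> space ?M \<in> sets ?M"
      using *[OF As(2)] As(1) by simp
  qed
qed

lemma prob_space_iid_list: "prob_space P \<Longrightarrow> prob_space (iid_list n P)"
  unfolding iid_list_def by (intro prob_space.prob_space_distr prob_space_PiM measurable_iid_map)

lemma sets_iid_list: "sets P = sets M \<Longrightarrow> sets (iid_list n P) = sets (list_space M)"
  unfolding iid_list_def using list_space_cong[of P M] by simp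

lemma emeasure_iid_list_listset:
  assumes "prob_space P" "set As \<subseteq> sets P"
  shows "emeasure (iid_list n P) (listset As)
           = (if length As = n then \<Prod>i\<in>{1..n}. emeasure P (As ! (i - 1)) else 0)"
proof -
  interpret prob_space P by fact
  interpret product_sigma_finite "\<lambda>_. P" ..
  have "As ! (i - 1) \<in> sets P" if "i \<in> {1..n}" "length As = n" for i
    using that by (auto intro!: subsetD[OF assms(2)] nth_mem)
  then show ?thesis
    unfolding iid_list_def
    by (subst emeasure_distr[OF measurable_iid_map listset_in_sets[OF assms(2)]],
        subst vimage_iid_map[OF assms(2)])
      (auto intro!: emeasure_PiM)
qed

lemma Int_stable_listset: "Int_stable {listset As |As. As \<in> lists (sets M)}"
proof (rule Int_stableI)
  fix a b assume "a \<in> {listset As |As. As \<in> lists (sets M)}" "b \<in> {listset As |As. As \<in> lists (sets M)}"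
  then obtain As Bs where ab: "a = listset As" "b = listset Bs"
    and AB: "As \<in> lists (sets M)" "Bs \<in> lists (sets M)" by blast
  have "\<exists>Cs. listset As \<inter> listset Bs = listset Cs \<and> Cs \<in> lists (sets M)"
  proof (cases "length As = length Bs")
    case True
    have "listset As \<inter> listset Bs = listset (map2 (\<inter>) As Bs)"
      using True by (auto simp: mem_listset_iff list_all2_conv_all_nth)
    moreover have "map2 (\<inter>) As Bs \<in> lists (sets M)"
    proof -
      have "a \<inter> b \<in> sets M" if "(a, b) \<in> set (zip As Bs)" for a b
        using AB set_zip_leftD[OF that] set_zip_rightD[OF that] by (intro sets.Int) auto
      then show ?thesis by auto
    qed
    ultimately show ?thesis by blast
  next
    case False
    then have "listset As \<inter> listset Bs = listset [{}]"
      by (auto simp: mem_listset_iff list_all2_conv_all_nth)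
    moreover have "[{}] \<in> lists (sets M)" by simp
    ultimately show ?thesis by blast
  qed
  then show "a \<inter> b \<in> {listset As |As. As \<in> lists (sets M)}" using ab by blast
qed

text \<open>The rectangles \<open>listset As\<close> are stable under intersection and generate the \<open>\<sigma>\<close>-algebra, and
  the probability of a rectangle is a finite product of measurable functions.\<close>

lemma measurable_iid_list:
  assumes P: "P \<in> M \<rightarrow>\<^sub>M prob_algebra N"
  shows "(\<lambda>x. iid_list n (P x)) \<in> M \<rightarrow>\<^sub>M prob_algebra (list_space N)"
proof (rule measurable_prob_algebra_generated[OF sets_list_space Int_stable_listset listset_sets_subset])
  have Px: "prob_space (P x)" "sets (P x) = sets N" if "x \<in> space M" for x
    using measurable_space[OF P that] by (auto simp: space_prob_algebra)
  show "prob_space (iid_list n (P x))" if "x \<in> space M" for x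
    using Px(1)[OF that] by (rule prob_space_iid_list)
  show "sets (iid_list n (P x)) = sets (list_space N)" if "x \<in> space M" for x
    using Px(2)[OF that] by (rule sets_iid_list)
  fix A assume "A \<in> {listset As |As. As \<in> lists (sets N)}"
  then obtain As where As: "A = listset As" "set As \<subseteq> sets N" by auto
  have "(\<lambda>x. if length As = n then \<Prod>i\<in>{1..n}. emeasure (P x) (As ! (i - 1)) else 0)
      \<in> borel_measurable M"
  proof (cases "length As = n")
    case True
    have "(\<lambda>x. emeasure (P x) (As ! (i - 1))) \<in> borel_measurable M" if "i \<in> {1..n}" for i
    proof -
      have "As ! (i - 1) \<in> sets N" using that True by (auto intro!: subsetD[OF As(2)] nth_mem)
      then show ?thesis
        using measurable_compose[OF measurable_prob_algebraD[OF P] measurable_emeasure_subprob_algebra]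
        by blast
    qed
    then show ?thesis using True by simp
  qed simp
  then show "(\<lambda>x. emeasure (iid_list n (P x)) A) \<in> borel_measurable M"
    by (rule measurable_cong[THEN iffD1, rotated])
      (use As Px in \<open>simp add: emeasure_iid_list_listset\<close>)
qed

text \<open>Counting ordered instead of unordered pairs turns the binomial coefficient into a double sum of
  indicators, which expectations can enter.\<close>

lemma choose_two_eq_pairs:
  assumes "finite I" "B \<subseteq> I"
  shows "2 * real (card B choose 2) = (\<Sum>i\<in>I. \<Sum>j\<in>I - {i}. of_bool (i \<in> B \<and> j \<in> B))"
proof -
  have fin: "finite B" using assms finite_subset by blast
  have "(\<Sum>j\<in>I - {i}. of_bool (i \<in> B \<and> j \<in> B)) = (if i \<in> B then real (card B) - 1 else 0)" for i
  proof (cases "i \<in> B")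
    case True
    have "(I - {i}) \<inter> {j. i \<in> B \<and> j \<in> B} = B - {i}" using assms True by auto
    then have "(\<Sum>j\<in>I - {i}. of_bool (i \<in> B \<and> j \<in> B)) = real (card (B - {i}))"
      using assms by (simp only: sum_of_bool_eq finite_Diff)
    also have "\<dots> = real (card B) - 1"
    proof -
      have "0 < card B" using True fin by (auto simp: card_gt_0_iff)
      then show ?thesis using True by (simp add: card_Diff_singleton of_nat_diff)
    qed
    finally show ?thesis using True by simp
  qed simp
  then have "(\<Sum>i\<in>I. \<Sum>j\<in>I - {i}. of_bool (i \<in> B \<and> j \<in> B)) = real (card B) * (real (card B) - 1)"
    using assms by (simp add: sum.If_cases Int_absorb1)
  moreover have "even (card B * (card B - 1))" by (cases "card B") auto
  then have "2 * (card B choose 2) = card B * (card B - 1)"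
    by (simp add: choose_two dvd_mult_div_cancel)
  then have "2 * real (card B choose 2) = real (card B * (card B - 1))"
    by (metis of_nat_mult of_nat_numeral)
  then have "2 * real (card B choose 2) = real (card B) * (real (card B) - 1)"
    by (cases "card B") (simp_all add: algebra_simps)
  ultimately show ?thesis by simp
qed

lemma exceed_count_iid_map:
  "exceed_count s t (x, map \<omega> [1..<Suc n]) = card {i \<in> {1..n}. t < ereal (s (x, \<omega> i))}"
proof -
  have "{i \<in> {1..n}. t < ereal (s (obs (x, map \<omega> [1..<Suc n]) i))}
      = {i \<in> {1..n}. t < ereal (s (x, \<omega> i))}"
    by (auto simp: obs_def simp del: upt_Suc)
  then show ?thesis by (simp add: exceed_count_def del: upt_Suc)
qed

text \<open>By linearity: each of the \<open>n (n - 1)\<close> ordered pairs of distinct indices has both scores above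
  \<open>t\<close> with the same probability \<open>q\<^sup>2\<close>, by independence. The pairs overlap, but this does not affect
  expectations.\<close>

lemma expectation_pair_exceed:
  assumes "prob_space P" and A [measurable]: "{y \<in> space P. t < ereal (s (x, y))} \<in> sets P"
  shows "(\<integral>\<omega>. pair_exceed s t (x, map \<omega> [1..<Suc n]) \<partial>(\<Pi>\<^sub>M i\<in>{1..n}. P))
           = (if 2 \<le> n then (measure P {y \<in> space P. t < ereal (s (x, y))})\<^sup>2 else 0)"
proof (cases "2 \<le> n")
  case False
  then show ?thesis by (simp add: pair_exceed_small del: upt_Suc)
next
  case True
  interpret Q: prob_space P by fact
  interpret product_prob_space "\<lambda>_. P" "{1..n}" ..
  define A where "A = {y \<in> space P. t < ereal (s (x, y))}"
  let ?M = "\<Pi>\<^sub>M i\<in>{1..n}. P"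
  have [measurable]: "A \<in> sets P" using A by (simp add: A_def)
  define E where "E i j = {\<omega> \<in> space ?M. \<forall>k\<in>{i, j}. \<omega> k \<in> A}" for i j :: nat
  have E: "E i j \<in> sets ?M" "measure ?M (E i j) = (measure P A)\<^sup>2"
    if "i \<in> {1..n}" "j \<in> {1..n} - {i}" for i j
  proof -
    have "emeasure ?M (E i j) = (\<Prod>k\<in>{i, j}. emeasure P A)"
      unfolding E_def using that by (intro emeasure_PiM_Collect) auto
    also have "\<dots> = ennreal ((measure P A)\<^sup>2)"
      using that by (simp add: Q.emeasure_eq_measure power2_eq_square ennreal_mult)
    finally show "measure ?M (E i j) = (measure P A)\<^sup>2"
      by (simp add: measure_def)
    have [measurable]: "(\<lambda>\<omega>. \<omega> i) \<in> ?M \<rightarrow>\<^sub>M P" "(\<lambda>\<omega>. \<omega> j) \<in> ?M \<rightarrow>\<^sub>M P"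
      using that by (auto intro: measurable_component_singleton)
    have "E i j = {\<omega> \<in> space ?M. \<omega> i \<in> A \<and> \<omega> j \<in> A}" by (auto simp: E_def)
    also have "\<dots> \<in> sets ?M" by measurable
    finally show "E i j \<in> sets ?M" .
  qed
  define c where "c = 2 * real (n choose 2)"
  have c: "c = real n * (real n - 1)" "0 < c"
  proof -
    have "c = real n * (real n - 1)"
      using choose_two_eq_pairs[of "{1..n}" "{1..n}"] unfolding c_def by simp
    then show "c = real n * (real n - 1)" .
    then show "0 < c" using True by simp
  qed
  have "pair_exceed s t (x, map \<omega> [1..<Suc n])
      = (\<Sum>i\<in>{1..n}. \<Sum>j\<in>{1..n} - {i}. indicat_real (E i j) \<omega>) / c" if "\<omega> \<in> space ?M" for \<omega>
  proof -
    have sp: "\<omega> i \<in> space P" if "i \<in> {1..n}" for i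
      using \<open>\<omega> \<in> space ?M\<close> that by (auto simp: space_PiM)
    have eq: "2 * real (exceed_count s t (x, map \<omega> [1..<Suc n]) choose 2)
        = (\<Sum>i\<in>{1..n}. \<Sum>j\<in>{1..n} - {i}. indicat_real (E i j) \<omega>)"
      unfolding exceed_count_iid_map
      by (subst choose_two_eq_pairs[of "{1..n}"])
        (use \<open>\<omega> \<in> space ?M\<close> sp in \<open>auto simp: E_def A_def indicator_def intro!: sum.cong\<close>)
    show ?thesis unfolding eq[symmetric] pair_exceed_def c_def by (simp del: upt_Suc)
  qed
  then have "(\<integral>\<omega>. pair_exceed s t (x, map \<omega> [1..<Suc n]) \<partial>?M)
      = (\<integral>\<omega>. (\<Sum>i\<in>{1..n}. \<Sum>j\<in>{1..n} - {i}. indicat_real (E i j) \<omega>) / c \<partial>?M)"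
    by (intro Bochner_Integration.integral_cong refl)
  also have "\<dots> = (\<Sum>i\<in>{1..n}. \<Sum>j\<in>{1..n} - {i}. (measure P A)\<^sup>2) / c"
  proof -
    have int: "integrable ?M (indicat_real (E i j))" if "i \<in> {1..n}" "j \<in> {1..n} - {i}" for i j
    proof (rule integrable_real_indicator[OF E(1)[OF that]])
      have "prob_space ?M" by (intro prob_space_PiM Q.prob_space_axioms)
      then have "emeasure ?M (E i j) \<noteq> top"
        by (intro finite_measure.emeasure_finite prob_space.axioms(1))
      then show "emeasure ?M (E i j) < \<infinity>" by (simp add: less_top)
    qed
    have "(\<integral>\<omega>. (\<Sum>i\<in>{1..n}. \<Sum>j\<in>{1..n} - {i}. indicat_real (E i j) \<omega>) \<partial>?M)
        = (\<Sum>i\<in>{1..n}. \<integral>\<omega>. (\<Sum>j\<in>{1..n} - {i}. indicat_real (E i j) \<omega>) \<partial>?M)"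
      by (intro Bochner_Integration.integral_sum Bochner_Integration.integrable_sum int)
    also have "\<dots> = (\<Sum>i\<in>{1..n}. \<Sum>j\<in>{1..n} - {i}. \<integral>\<omega>. indicat_real (E i j) \<omega> \<partial>?M)"
      by (intro sum.cong refl Bochner_Integration.integral_sum int)
    also have "\<dots> = (\<Sum>i\<in>{1..n}. \<Sum>j\<in>{1..n} - {i}. (measure P A)\<^sup>2)"
    proof (intro sum.cong refl)
      fix i j assume ij: "i \<in> {1..n}" "j \<in> {1..n} - {i}"
      have "E i j \<inter> space ?M = E i j" using E(1)[OF ij] by (rule sets.Int_space_eq2)
      then show "(\<integral>\<omega>. indicat_real (E i j) \<omega> \<partial>?M) = (measure P A)\<^sup>2"
        using E(2)[OF ij] by simp
    qed
    finally show ?thesis by simp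
  qed
  also have "\<dots> = (measure P A)\<^sup>2"
    using c True by (simp add: of_nat_diff)
  finally show ?thesis using True by (simp add: A_def del: upt_Suc)
qed

section \<open>The repeated-measurements model\<close>

locale repeated_measurements =
  fixes MX :: "'x measure" and MY :: "'y measure"
    and PX :: "'x measure" and PN :: "'x \<Rightarrow> nat measure" and PY :: "'x \<Rightarrow> 'y measure"
  assumes prob_PX: "prob_space PX" and sets_PX: "sets PX = sets MX"
    and PN: "PN \<in> MX \<rightarrow>\<^sub>M prob_algebra (count_space {1..})"
    and PY: "PY \<in> MX \<rightarrow>\<^sub>M prob_algebra MY"
begin

lemma space_PX: "space PX = space MX"
  using sets_PX by (rule sets_eq_imp_space_eq)

lemma PX_in: "PX \<in> space (prob_algebra MX)"
  using prob_PX sets_PX by (simp add: space_prob_algebra)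

lemma PN_at: "x \<in> space MX \<Longrightarrow> prob_space (PN x) \<and> sets (PN x) = sets (count_space {1..})"
  using measurable_space[OF PN] by (simp add: space_prob_algebra)

lemma space_PN: "x \<in> space MX \<Longrightarrow> space (PN x) = {1..}"
  using PN_at sets_eq_imp_space_eq[of "PN x" "count_space {1..}"] by simp

lemma PY_at: "x \<in> space MX \<Longrightarrow> prob_space (PY x) \<and> sets (PY x) = sets MY"
  using measurable_space[OF PY] by (simp add: space_prob_algebra)

lemma space_PY: "x \<in> space MX \<Longrightarrow> space (PY x) = space MY"
  using PY_at sets_eq_imp_space_eq[of "PY x" MY] by blast

lemma space_MX_nonempty: "space MX \<noteq> {}"
  using prob_space.not_empty[OF prob_PX] by (simp add: space_PX)

lemma space_MY_nonempty: "space MY \<noteq> {}"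
  using space_MX_nonempty PY_at space_PY prob_space.not_empty by fastforce

text \<open>The sample size takes countably many values, so measurability in the pair \<open>(x, n)\<close> follows
  from measurability in \<open>x\<close> for each \<open>n\<close>.\<close>

lemma iid_list_kernel:
  "(\<lambda>xn. iid_list (snd xn) (PY (fst xn))) \<in> MX \<Otimes>\<^sub>M count_space {1..} \<rightarrow>\<^sub>M prob_algebra (list_space MY)"
proof (rule measurable_compose_countable'[where I = "{1..}"])
  show "(\<lambda>xn. iid_list n (PY (fst xn))) \<in> MX \<Otimes>\<^sub>M count_space {1..} \<rightarrow>\<^sub>M prob_algebra (list_space MY)"
    for n
    by (rule measurable_compose[OF measurable_fst measurable_iid_list[OF PY]])
qed auto

lemma responses_kernel:
  "(\<lambda>xn. iid_list (snd xn) (PY (fst xn)) \<bind> (\<lambda>ys. return (grp_space MX MY) (fst xn, ys)))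
     \<in> MX \<Otimes>\<^sub>M count_space {1..} \<rightarrow>\<^sub>M prob_algebra (grp_space MX MY)"
  by (rule measurable_bind_prob_space2[OF iid_list_kernel], unfold grp_space_def) measurable

lemma grp_kernel:
  "(\<lambda>x. PN x \<bind> (\<lambda>n. iid_list n (PY x) \<bind> (\<lambda>ys. return (grp_space MX MY) (x, ys))))
     \<in> MX \<rightarrow>\<^sub>M prob_algebra (grp_space MX MY)"
  by (rule measurable_bind_prob_space2[OF PN]) (use responses_kernel in \<open>simp add: case_prod_beta\<close>)

lemma XN_kernel:
  "(\<lambda>x. PN x \<bind> (\<lambda>n. return (PX \<Otimes>\<^sub>M count_space {1..}) (x, n)))
     \<in> MX \<rightarrow>\<^sub>M prob_algebra (PX \<Otimes>\<^sub>M count_space {1..})"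
proof (rule measurable_bind_prob_space2[OF PN])
  have [measurable_cong]: "sets PX = sets MX" by (rule sets_PX)
  show "(\<lambda>(x, n). return (PX \<Otimes>\<^sub>M count_space {1..}) (x, n))
    \<in> MX \<Otimes>\<^sub>M count_space {1..} \<rightarrow>\<^sub>M prob_algebra (PX \<Otimes>\<^sub>M count_space {1..})"
    by measurable
qed

lemma prob_space_grp_law: "prob_space (grp_law MX MY PX PN PY)"
  unfolding grp_law_def by (rule prob_space_bind'[OF PX_in grp_kernel])

lemma sets_grp_law: "sets (grp_law MX MY PX PN PY) = sets (grp_space MX MY)"
  unfolding grp_law_def by (rule sets_bind'[OF PX_in grp_kernel])

lemma prob_space_XN_law: "prob_space (XN_law PX PN)"
  unfolding XN_law_def by (rule prob_space_bind'[OF PX_in XN_kernel])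

lemma sets_XN_law: "sets (XN_law PX PN) = sets (MX \<Otimes>\<^sub>M count_space {1..})"
  unfolding XN_law_def using sets_bind'[OF PX_in XN_kernel] sets_pair_measure_cong[OF sets_PX refl]
  by blast

lemma measurable_from_PX: "f \<in> MX \<rightarrow>\<^sub>M N \<Longrightarrow> f \<in> PX \<rightarrow>\<^sub>M N"
  using measurable_cong_sets[OF sets_PX refl] by blast

lemma nn_integral_grp_law:
  assumes f: "f \<in> borel_measurable (grp_space MX MY)"
  shows "(\<integral>\<^sup>+g. f g \<partial>grp_law MX MY PX PN PY)
    = (\<integral>\<^sup>+x. \<integral>\<^sup>+n. \<integral>\<^sup>+ys. f (x, ys) \<partial>iid_list n (PY x) \<partial>PN x \<partial>PX)"
proof -
  have "(\<integral>\<^sup>+g. f g \<partial>grp_law MX MY PX PN PY) = (\<integral>\<^sup>+x. \<integral>\<^sup>+g. f g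
      \<partial>(PN x \<bind> (\<lambda>n. iid_list n (PY x) \<bind> (\<lambda>ys. return (grp_space MX MY) (x, ys)))) \<partial>PX)"
    unfolding grp_law_def
    by (rule nn_integral_bind[OF f measurable_from_PX[OF measurable_prob_algebraD[OF grp_kernel]]])
  also have "\<dots> = (\<integral>\<^sup>+x. \<integral>\<^sup>+n. \<integral>\<^sup>+g. f g
      \<partial>(iid_list n (PY x) \<bind> (\<lambda>ys. return (grp_space MX MY) (x, ys))) \<partial>PN x \<partial>PX)"
  proof (intro nn_integral_cong nn_integral_bind[OF f])
    fix x assume "x \<in> space PX"
    then have x: "x \<in> space MX" by (simp add: space_PX)
    have "(\<lambda>n. (x, n)) \<in> count_space {1..} \<rightarrow>\<^sub>M MX \<Otimes>\<^sub>M count_space {1..}"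
      using x by (rule measurable_Pair1')
    note comp = measurable_compose[OF this measurable_prob_algebraD[OF responses_kernel]]
    show "(\<lambda>n. iid_list n (PY x) \<bind> (\<lambda>ys. return (grp_space MX MY) (x, ys)))
        \<in> PN x \<rightarrow>\<^sub>M subprob_algebra (grp_space MX MY)"
      by (subst measurable_cong_sets[OF conjunct2[OF PN_at[OF x]] refl]) (use comp in simp)
  qed
  also have "\<dots> = (\<integral>\<^sup>+x. \<integral>\<^sup>+n. \<integral>\<^sup>+ys. f (x, ys) \<partial>iid_list n (PY x) \<partial>PN x \<partial>PX)"
  proof (intro nn_integral_cong)
    fix x n assume "x \<in> space PX" "n \<in> space (PN x)"
    then have x: "x \<in> space MX" by (simp add: space_PX)
    have ret: "(\<lambda>ys. return (grp_space MX MY) (x, ys))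
        \<in> iid_list n (PY x) \<rightarrow>\<^sub>M subprob_algebra (grp_space MX MY)"
      using x sets_iid_list[of "PY x" MY n] PY_at[OF x]
      by (subst measurable_cong_sets[OF _ refl])
        (auto simp: grp_space_def intro!: measurable_compose[OF _ return_measurable])
    have sp: "space (iid_list n (PY x)) = space (list_space MY)"
      using sets_iid_list[of "PY x" MY n] PY_at[OF x] sets_eq_imp_space_eq by blast
    show "(\<integral>\<^sup>+g. f g \<partial>(iid_list n (PY x) \<bind> (\<lambda>ys. return (grp_space MX MY) (x, ys))))
        = (\<integral>\<^sup>+ys. f (x, ys) \<partial>iid_list n (PY x))"
      using x sp unfolding nn_integral_bind[OF f ret]
      by (intro nn_integral_cong nn_integral_return f) (auto simp: grp_space_def space_pair_measure)
  qed
  finally show ?thesis .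
qed

lemma nn_integral_XN_law:
  assumes f: "f \<in> borel_measurable (MX \<Otimes>\<^sub>M count_space {1..})"
  shows "(\<integral>\<^sup>+\<omega>. f \<omega> \<partial>XN_law PX PN) = (\<integral>\<^sup>+x. \<integral>\<^sup>+n. f (x, n) \<partial>PN x \<partial>PX)"
proof -
  have eq: "sets (PX \<Otimes>\<^sub>M count_space {1..}) = sets (MX \<Otimes>\<^sub>M count_space {1..})"
    by (rule sets_pair_measure_cong[OF sets_PX refl])
  have f': "f \<in> borel_measurable (PX \<Otimes>\<^sub>M count_space {1..})"
    using f unfolding measurable_cong_sets[OF eq refl] .
  have "(\<integral>\<^sup>+\<omega>. f \<omega> \<partial>XN_law PX PN)
      = (\<integral>\<^sup>+x. \<integral>\<^sup>+\<omega>. f \<omega> \<partial>(PN x \<bind> (\<lambda>n. return (PX \<Otimes>\<^sub>M count_space {1..}) (x, n))) \<partial>PX)"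
    unfolding XN_law_def
    by (rule nn_integral_bind[OF f' measurable_from_PX[OF measurable_prob_algebraD[OF XN_kernel]]])
  also have "\<dots> = (\<integral>\<^sup>+x. \<integral>\<^sup>+n. f (x, n) \<partial>PN x \<partial>PX)"
  proof (intro nn_integral_cong)
    fix x assume x: "x \<in> space PX"
    then have x': "x \<in> space MX" by (simp add: space_PX)
    have ret: "(\<lambda>n. return (PX \<Otimes>\<^sub>M count_space {1..}) (x, n))
        \<in> PN x \<rightarrow>\<^sub>M subprob_algebra (PX \<Otimes>\<^sub>M count_space {1..})"
      by (subst measurable_cong_sets[OF conjunct2[OF PN_at[OF x']] refl])
        (rule measurable_compose[OF measurable_Pair1'[OF x] return_measurable])
    show "(\<integral>\<^sup>+\<omega>. f \<omega> \<partial>(PN x \<bind> (\<lambda>n. return (PX \<Otimes>\<^sub>M count_space {1..}) (x, n))))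
        = (\<integral>\<^sup>+n. f (x, n) \<partial>PN x)"
      using x space_PN[OF x'] unfolding nn_integral_bind[OF f' ret]
      by (intro nn_integral_cong nn_integral_return f') (auto simp: space_pair_measure)
  qed
  finally show ?thesis .
qed

lemma measurable_ge2:
  "(\<lambda>\<omega>. indicator {2..} (snd \<omega>) :: ennreal) \<in> borel_measurable (MX \<Otimes>\<^sub>M count_space {1..})"
  by (rule measurable_compose[OF measurable_snd]) simp

lemma ge2_in_sets: "{n \<in> space (PN x). 2 \<le> n} \<in> sets (PN x)" if "x \<in> space MX"
  using PN_at[OF that] space_PN[OF that] by auto

lemma p_ge2_eq: "ennreal (p_ge2 PX PN) = (\<integral>\<^sup>+x. emeasure (PN x) {n \<in> space (PN x). 2 \<le> n} \<partial>PX)"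
proof -
  interpret XN: prob_space "XN_law PX PN" by (rule prob_space_XN_law)
  note [measurable_cong] = sets_XN_law
  have "{\<omega> \<in> space (XN_law PX PN). 2 \<le> snd \<omega>} \<in> sets (XN_law PX PN)" by measurable
  then have "ennreal (p_ge2 PX PN)
      = (\<integral>\<^sup>+\<omega>. indicator {\<omega> \<in> space (XN_law PX PN). 2 \<le> snd \<omega>} \<omega> \<partial>XN_law PX PN)"
    unfolding p_ge2_def XN.emeasure_eq_measure[symmetric] by (rule nn_integral_indicator[symmetric])
  also have "\<dots> = (\<integral>\<^sup>+\<omega>. indicator {2..} (snd \<omega>) \<partial>XN_law PX PN)"
    by (intro nn_integral_cong) (auto simp: indicator_def)
  also have "\<dots> = (\<integral>\<^sup>+x. \<integral>\<^sup>+n. indicator {2..} n \<partial>PN x \<partial>PX)"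
    by (subst nn_integral_XN_law[OF measurable_ge2]) simp
  also have "\<dots> = (\<integral>\<^sup>+x. emeasure (PN x) {n \<in> space (PN x). 2 \<le> n} \<partial>PX)"
  proof (intro nn_integral_cong)
    fix x assume "x \<in> space PX"
    then have "x \<in> space MX" by (simp add: space_PX)
    have "(\<integral>\<^sup>+n. indicator {2..} n \<partial>PN x)
        = (\<integral>\<^sup>+n. indicator {n \<in> space (PN x). 2 \<le> n} n \<partial>PN x)"
      by (intro nn_integral_cong) (auto simp: indicator_def)
    also have "\<dots> = emeasure (PN x) {n \<in> space (PN x). 2 \<le> n}"
      by (rule nn_integral_indicator[OF ge2_in_sets[OF \<open>x \<in> space MX\<close>]])
    finally show "(\<integral>\<^sup>+n. indicator {2..} n \<partial>PN x) = emeasure (PN x) {n \<in> space (PN x). 2 \<le> n}" .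
  qed
  finally show ?thesis .
qed

text \<open>Conditioning the covariate on at least two measurements reweights its law by the conditional
  probability of that event given \<open>x\<close>, up to the normalisation \<open>p_ge2\<close>.\<close>

lemma nn_integral_PX_ge2:
  assumes f: "f \<in> borel_measurable MX" and p: "0 < p_ge2 PX PN"
  shows "ennreal (p_ge2 PX PN) * (\<integral>\<^sup>+x. f x \<partial>PX_ge2 PX PN)
    = (\<integral>\<^sup>+x. f x * emeasure (PN x) {n \<in> space (PN x). 2 \<le> n} \<partial>PX)"
proof -
  interpret XN: prob_space "XN_law PX PN" by (rule prob_space_XN_law)
  note [measurable_cong] = sets_XN_law sets_PX
  note [measurable] = f
  define A where "A = {\<omega> \<in> space (XN_law PX PN). 2 \<le> snd \<omega>}"
  have A [measurable]: "A \<in> sets (XN_law PX PN)" unfolding A_def by measurable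
  have p_A: "emeasure (XN_law PX PN) A = ennreal (p_ge2 PX PN)"
    unfolding p_ge2_def A_def XN.emeasure_eq_measure ..
  have "(\<integral>\<^sup>+x. f x \<partial>PX_ge2 PX PN) = (\<integral>\<^sup>+\<omega>. f (fst \<omega>) \<partial>uniform_measure (XN_law PX PN) A)"
    unfolding PX_ge2_def A_def[symmetric]
    by (rule nn_integral_distr) measurable
  also have "\<dots> = (\<integral>\<^sup>+\<omega>. f (fst \<omega>) * indicator A \<omega> \<partial>XN_law PX PN) / emeasure (XN_law PX PN) A"
    by (rule nn_integral_uniform_measure) measurable
  finally have "ennreal (p_ge2 PX PN) * (\<integral>\<^sup>+x. f x \<partial>PX_ge2 PX PN)
      = (\<integral>\<^sup>+\<omega>. f (fst \<omega>) * indicator A \<omega> \<partial>XN_law PX PN)"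
    using p unfolding p_A
    by (simp add: ennreal_times_divide mult.commute[of "ennreal _"] mult_divide_eq_ennreal)
  also have "\<dots> = (\<integral>\<^sup>+\<omega>. f (fst \<omega>) * indicator {2..} (snd \<omega>) \<partial>XN_law PX PN)"
    by (intro nn_integral_cong) (auto simp: A_def indicator_def)
  also have "\<dots> = (\<integral>\<^sup>+x. \<integral>\<^sup>+n. f x * indicator {2..} n \<partial>PN x \<partial>PX)"
  proof -
    have "(\<lambda>\<omega>. f (fst \<omega>) * indicator {2..} (snd \<omega>)) \<in> borel_measurable (MX \<Otimes>\<^sub>M count_space {1..})"
      by (intro borel_measurable_times_ennreal measurable_ge2 measurable_compose[OF measurable_fst f])
    from nn_integral_XN_law[OF this] show ?thesis by simp
  qed
  also have "\<dots> = (\<integral>\<^sup>+x. f x * emeasure (PN x) {n \<in> space (PN x). 2 \<le> n} \<partial>PX)"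
  proof (intro nn_integral_cong)
    fix x assume "x \<in> space PX"
    then have x: "x \<in> space MX" by (simp add: space_PX)
    have "(\<integral>\<^sup>+n. f x * indicator {2..} n \<partial>PN x)
        = (\<integral>\<^sup>+n. f x * indicator {n \<in> space (PN x). 2 \<le> n} n \<partial>PN x)"
      by (intro nn_integral_cong) (auto simp: indicator_def)
    then show "(\<integral>\<^sup>+n. f x * indicator {2..} n \<partial>PN x)
        = f x * emeasure (PN x) {n \<in> space (PN x). 2 \<le> n}"
      using nn_integral_cmult_indicator[OF ge2_in_sets[OF x]] by simp
  qed
  finally show ?thesis .
qed

end

context repeated_measurements
begin

lemma fixed_score:
  assumes "s \<in> borel_measurable (MX \<Otimes>\<^sub>M MY)"
  shows "measurable_scores MX MY W (\<lambda>_. s)"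
proof
  show "(\<lambda>(w, z). s z) \<in> borel_measurable (W \<Otimes>\<^sub>M (MX \<Otimes>\<^sub>M MY))"
    unfolding split_def by (rule measurable_compose[OF measurable_snd assms])
qed (rule space_MY_nonempty)

lemma nn_integral_iid_pair_exceed:
  assumes s: "s \<in> borel_measurable (MX \<Otimes>\<^sub>M MY)" and x: "x \<in> space MX"
  shows "(\<integral>\<^sup>+ys. ennreal (pair_exceed s t (x, ys)) \<partial>iid_list n (PY x))
    = ennreal (if 2 \<le> n then (measure (PY x) {y \<in> space MY. t < ereal (s (x, y))})\<^sup>2 else 0)"
proof -
  interpret P: prob_space "PY x" using PY_at[OF x] by simp
  interpret sc: measurable_scores MX MY "list_space MY" "\<lambda>_. s"
    using s by (rule fixed_score)
  have pairM: "(\<lambda>ys. (x, ys)) \<in> list_space MY \<rightarrow>\<^sub>M grp_space MX MY"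
    unfolding grp_space_def using x by (rule measurable_Pair1')
  have "(\<lambda>ys. pair_exceed s t (x, ys)) \<in> borel_measurable (list_space MY)"
    using sc.measurable_pair_exceed[OF pairM, of "\<lambda>_. t"] by simp
  moreover have "list_space (PY x) = list_space MY"
    using PY_at[OF x] by (intro list_space_cong) simp
  ultimately have meas: "(\<lambda>ys. pair_exceed s t (x, ys)) \<in> borel_measurable (list_space (PY x))"
    by simp
  let ?M = "\<Pi>\<^sub>M i\<in>{1..n}. PY x"
  interpret M: prob_space ?M by (intro prob_space_PiM P.prob_space_axioms)
  have meas': "(\<lambda>\<omega>. pair_exceed s t (x, map \<omega> [1..<Suc n])) \<in> borel_measurable ?M"
    by (rule measurable_compose[OF measurable_iid_map meas])
  have int: "integrable ?M (\<lambda>\<omega>. pair_exceed s t (x, map \<omega> [1..<Suc n]))"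
    using meas' by (intro M.integrable_const_bound[where B = 1])
      (auto simp: pair_exceed_nonneg pair_exceed_le_one simp del: upt_Suc)
  have "(\<integral>\<^sup>+ys. ennreal (pair_exceed s t (x, ys)) \<partial>iid_list n (PY x))
      = (\<integral>\<^sup>+\<omega>. ennreal (pair_exceed s t (x, map \<omega> [1..<Suc n])) \<partial>?M)"
    unfolding iid_list_def
    by (rule nn_integral_distr[OF measurable_iid_map]) (use meas in simp)
  also have "\<dots> = ennreal (\<integral>\<omega>. pair_exceed s t (x, map \<omega> [1..<Suc n]) \<partial>?M)"
    by (rule nn_integral_eq_integral[OF int]) (simp add: pair_exceed_nonneg)
  also have "(\<integral>\<omega>. pair_exceed s t (x, map \<omega> [1..<Suc n]) \<partial>?M)
      = (if 2 \<le> n then (measure (PY x) {y \<in> space (PY x). t < ereal (s (x, y))})\<^sup>2 else 0)"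
  proof (rule expectation_pair_exceed[OF P.prob_space_axioms])
    have "(\<lambda>y. s (x, y)) \<in> borel_measurable (PY x)"
      by (subst measurable_cong_sets[OF conjunct2[OF PY_at[OF x]] refl])
        (rule measurable_compose[OF measurable_Pair1'[OF x] s])
    then show "{y \<in> space (PY x). t < ereal (s (x, y))} \<in> sets (PY x)" by measurable
  qed
  finally show ?thesis by (simp add: space_PY[OF x])
qed

lemma measurable_squared_exceedance:
  assumes s [measurable]: "s \<in> borel_measurable (MX \<Otimes>\<^sub>M MY)"
  shows "(\<lambda>x. (measure (PY x) {y \<in> space MY. t < ereal (s (x, y))})\<^sup>2) \<in> borel_measurable MX"
proof -
  have "(SIGMA x:space MX. {y \<in> space MY. t < ereal (s (x, y))})
      = {z \<in> space (MX \<Otimes>\<^sub>M MY). t < ereal (s z)}"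
    by (auto simp: space_pair_measure)
  also have "\<dots> \<in> sets (MX \<Otimes>\<^sub>M MY)" by measurable
  finally have "(\<lambda>x. measure (PY x) {y \<in> space MY. t < ereal (s (x, y))}) \<in> borel_measurable MX"
    by (rule measure_measurable_prob_algebra2[OF _ PY])
  then show ?thesis by measurable
qed

text \<open>For a fixed score function and threshold, the pair exceedance of a random group estimates
  the squared miscoverage without bias. Averaging over the sizes of at least two produces exactly
  the reweighting of the covariate law, since the conditional expectation given \<open>x\<close> and \<open>n\<close> does
  not depend on \<open>n \<ge> 2\<close>.\<close>

lemma nn_integral_pair_exceed:
  assumes s: "s \<in> borel_measurable (MX \<Otimes>\<^sub>M MY)" and p: "0 < p_ge2 PX PN"
  shows "(\<integral>\<^sup>+g. ennreal (pair_exceed s t g) \<partial>grp_law MX MY PX PN PY)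
    = ennreal (p_ge2 PX PN) *
      (\<integral>\<^sup>+x. ennreal ((measure (PY x) {y \<in> space MY. t < ereal (s (x, y))})\<^sup>2) \<partial>PX_ge2 PX PN)"
proof -
  interpret sc: measurable_scores MX MY "grp_space MX MY" "\<lambda>_. s"
    using s by (rule fixed_score)
  define q where "q x = (measure (PY x) {y \<in> space MY. t < ereal (s (x, y))})\<^sup>2" for x
  have q [measurable]: "q \<in> borel_measurable MX"
    unfolding q_def by (rule measurable_squared_exceedance[OF s])
  have "(\<lambda>g. pair_exceed s t g) \<in> borel_measurable (grp_space MX MY)"
    using sc.measurable_pair_exceed[of "\<lambda>g. g" "\<lambda>_. t"] by simp
  then have "(\<integral>\<^sup>+g. ennreal (pair_exceed s t g) \<partial>grp_law MX MY PX PN PY)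
      = (\<integral>\<^sup>+x. \<integral>\<^sup>+n. \<integral>\<^sup>+ys. ennreal (pair_exceed s t (x, ys)) \<partial>iid_list n (PY x) \<partial>PN x \<partial>PX)"
    by (intro nn_integral_grp_law) simp
  also have "\<dots> = (\<integral>\<^sup>+x. ennreal (q x) * emeasure (PN x) {n \<in> space (PN x). 2 \<le> n} \<partial>PX)"
  proof (intro nn_integral_cong)
    fix x assume "x \<in> space PX"
    then have x: "x \<in> space MX" by (simp add: space_PX)
    have "(\<integral>\<^sup>+n. \<integral>\<^sup>+ys. ennreal (pair_exceed s t (x, ys)) \<partial>iid_list n (PY x) \<partial>PN x)
        = (\<integral>\<^sup>+n. ennreal (q x) * indicator {n \<in> space (PN x). 2 \<le> n} n \<partial>PN x)"
      unfolding nn_integral_iid_pair_exceed[OF s x]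
      by (intro nn_integral_cong) (simp add: q_def indicator_def)
    then show "(\<integral>\<^sup>+n. \<integral>\<^sup>+ys. ennreal (pair_exceed s t (x, ys)) \<partial>iid_list n (PY x) \<partial>PN x)
        = ennreal (q x) * emeasure (PN x) {n \<in> space (PN x). 2 \<le> n}"
      using nn_integral_cmult_indicator[OF ge2_in_sets[OF x]] by simp
  qed
  also have "\<dots> = ennreal (p_ge2 PX PN) * (\<integral>\<^sup>+x. ennreal (q x) \<partial>PX_ge2 PX PN)"
    by (rule nn_integral_PX_ge2[OF _ p, symmetric]) simp
  finally show ?thesis by (simp add: q_def)
qed

lemma measurable_size_ge2:
  "(\<lambda>g. of_bool (2 \<le> grp_size g) :: real) \<in> borel_measurable (grp_space MX MY)"
proof -
  have "(\<lambda>g. grp_size g) \<in> grp_space MX MY \<rightarrow>\<^sub>M count_space UNIV"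
    unfolding grp_space_def by measurable
  from measurable_compose[OF this, of "\<lambda>n. of_bool (2 \<le> n) :: real" borel] show ?thesis by simp
qed

lemma integral_size_ge2:
  "(\<integral>g. of_bool (2 \<le> grp_size g) \<partial>grp_law MX MY PX PN PY) = p_ge2 PX PN"
proof -
  interpret G: prob_space "grp_law MX MY PX PN PY" by (rule prob_space_grp_law)
  have meas: "(\<lambda>g. of_bool (2 \<le> grp_size g) :: real) \<in> borel_measurable (grp_law MX MY PX PN PY)"
    using measurable_size_ge2 by (simp add: measurable_cong_sets[OF sets_grp_law refl])
  have "ennreal (\<integral>g. of_bool (2 \<le> grp_size g) \<partial>grp_law MX MY PX PN PY)
      = (\<integral>\<^sup>+g. ennreal (of_bool (2 \<le> grp_size g)) \<partial>grp_law MX MY PX PN PY)"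
    using meas by (intro nn_integral_eq_integral[symmetric] G.integrable_const_bound[where B = 1]) auto
  also have "\<dots> = (\<integral>\<^sup>+x. \<integral>\<^sup>+n. \<integral>\<^sup>+ys. ennreal (of_bool (2 \<le> length ys)) \<partial>iid_list n (PY x) \<partial>PN x \<partial>PX)"
    using measurable_compose[OF measurable_size_ge2 measurable_ennreal]
    by (subst nn_integral_grp_law) simp_all
  also have "\<dots> = (\<integral>\<^sup>+x. emeasure (PN x) {n \<in> space (PN x). 2 \<le> n} \<partial>PX)"
  proof (intro nn_integral_cong)
    fix x assume "x \<in> space PX"
    then have x: "x \<in> space MX" by (simp add: space_PX)
    then interpret P: prob_space "PY x" using PY_at by simp
    have inner: "(\<integral>\<^sup>+ys. ennreal (of_bool (2 \<le> length ys)) \<partial>iid_list n (PY x)) = of_bool (2 \<le> n)" for n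
    proof -
      interpret M: prob_space "\<Pi>\<^sub>M i\<in>{1..n}. PY x" by (intro prob_space_PiM P.prob_space_axioms)
      have "(\<lambda>ys. ennreal (of_bool (2 \<le> length ys))) \<in> borel_measurable (list_space (PY x))"
        by (rule measurable_compose[OF measurable_length_list_space]) simp
      then have "(\<integral>\<^sup>+ys. ennreal (of_bool (2 \<le> length ys)) \<partial>iid_list n (PY x))
          = (\<integral>\<^sup>+\<omega>. ennreal (of_bool (2 \<le> n)) \<partial>(\<Pi>\<^sub>M i\<in>{1..n}. PY x))"
        unfolding iid_list_def by (subst nn_integral_distr[OF measurable_iid_map]) (simp_all del: upt_Suc)
      then show ?thesis using M.emeasure_space_1 by simp
    qed
    have "(\<integral>\<^sup>+n. \<integral>\<^sup>+ys. ennreal (of_bool (2 \<le> length ys)) \<partial>iid_list n (PY x) \<partial>PN x)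
        = (\<integral>\<^sup>+n. indicator {n \<in> space (PN x). 2 \<le> n} n \<partial>PN x)"
      unfolding inner by (intro nn_integral_cong) (simp add: indicator_def)
    then show "(\<integral>\<^sup>+n. \<integral>\<^sup>+ys. ennreal (of_bool (2 \<le> length ys)) \<partial>iid_list n (PY x) \<partial>PN x)
        = emeasure (PN x) {n \<in> space (PN x). 2 \<le> n}"
      using nn_integral_indicator[OF ge2_in_sets[OF x]] by simp
  qed
  also have "\<dots> = ennreal (p_ge2 PX PN)" by (rule p_ge2_eq[symmetric])
  finally show ?thesis by (simp add: p_ge2_def)
qed

end

section \<open>Exchangeability of the calibration and test groups\<close>

lemma pair_threshold_reindex:
  assumes inj: "inj_on f J" and D': "\<And>j. j \<in> J \<Longrightarrow> D' j = D (f j)"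
  shows "pair_threshold s \<beta> J D' = pair_threshold s \<beta> (f ` J) D"
proof -
  have "big_groups (f ` J) D = f ` big_groups J D'" using D' by (auto simp: big_groups_def)
  moreover have "inj_on f (big_groups J D')"
    using inj by (rule inj_on_subset) (auto simp: big_groups_def)
  ultimately have "card (big_groups (f ` J) D) = card (big_groups J D')" by (simp add: card_image)
  moreover have "(\<Sum>k\<in>f ` J. pair_cdf s t (D k)) = (\<Sum>k\<in>J. pair_cdf s t (D' k))" for t
    using D' by (simp add: sum.reindex[OF inj])
  ultimately show ?thesis by (simp add: pair_threshold_def)
qed

lemma pair_threshold_cong:
  "(\<And>j. j \<in> J \<Longrightarrow> D' j = D j) \<Longrightarrow> pair_threshold s \<beta> J D' = pair_threshold s \<beta> J D"
  using pair_threshold_reindex[of "\<lambda>j. j" J D' D s \<beta>] by simp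

lemma fitted_score_cong:
  "(\<And>j. j \<in> {1..K0} \<Longrightarrow> D' j = D j) \<Longrightarrow> fitted_score S K0 D' = fitted_score S K0 D"
  unfolding fitted_score_def by (rule arg_cong[where f = S]) (auto simp: restrict_def)

locale hcp2 = repeated_measurements MX MY PX PN PY
  for MX :: "'x measure" and MY :: "'y measure"
    and PX :: "'x measure" and PN :: "'x \<Rightarrow> nat measure" and PY :: "'x \<Rightarrow> 'y measure" +
  fixes S :: "(nat \<Rightarrow> ('x, 'y) grp) \<Rightarrow> 'x \<times> 'y \<Rightarrow> real"
    and K0 K1 K :: nat and \<alpha> :: real
  assumes S: "(\<lambda>(D, z). S D z) \<in>
           borel_measurable ((\<Pi>\<^sub>M k\<in>{1..K0}. grp_space MX MY) \<Otimes>\<^sub>M (MX \<Otimes>\<^sub>M MY))"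
    and \<alpha>: "0 < \<alpha>" "\<alpha> < 1"
    and K: "K = K0 + K1"
    and p: "0 < p_ge2 PX PN"
begin

abbreviation "law \<equiv> grp_law MX MY PX PN PY"
abbreviation "groups J \<equiv> (\<Pi>\<^sub>M k\<in>J. law)"
abbreviation "score \<equiv> fitted_score S K0"

text \<open>The calibration groups together with group \<open>K + 1\<close>, an independent test group from the same
  law. These are the exchangeable groups.\<close>

definition pool :: "nat set" where "pool = {K0+1..K+1}"
definition all_groups :: "nat set" where "all_groups = {1..K+1}"

lemma index_sets:
  "finite pool" "pool \<subseteq> all_groups" "{1..K0} \<subseteq> all_groups" "K + 1 \<in> pool" "K + 1 \<in> all_groups" "card pool = K1 + 1"
  "pool - {K+1} = {K0+1..K}" "insert (K+1) {1..K} = all_groups"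
  unfolding pool_def all_groups_def using K by auto

text \<open>The pair exceedance of group \<open>k\<close> when it takes the role of the test group and all other groups
  of the pool are used for calibration.\<close>

definition loo_exceed :: "nat \<Rightarrow> (nat \<Rightarrow> ('x, 'y) grp) \<Rightarrow> real" where
  "loo_exceed k D = pair_exceed (score D) (pair_threshold (score D) (1 - \<alpha>\<^sup>2) (pool - {k}) D) (D k)"

lemma sets_groups: "sets (groups J) = sets (\<Pi>\<^sub>M k\<in>J. grp_space MX MY)"
  by (intro sets_PiM_cong refl sets_grp_law)

lemma prob_space_groups: "prob_space (groups J)"
  by (intro prob_space_PiM prob_space_grp_law)

lemma measurable_group: "k \<in> J \<Longrightarrow> (\<lambda>D. D k) \<in> groups J \<rightarrow>\<^sub>M grp_space MX MY"
  unfolding measurable_cong_sets[OF sets_groups refl] by (rule measurable_component_singleton)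

lemma measurable_scores_fitted: "{1..K0} \<subseteq> J \<Longrightarrow> measurable_scores MX MY (groups J) score"
proof
  assume J: "{1..K0} \<subseteq> J"
  have "(\<lambda>D. restrict D {1..K0}) \<in> groups J \<rightarrow>\<^sub>M (\<Pi>\<^sub>M k\<in>{1..K0}. grp_space MX MY)"
    unfolding measurable_cong_sets[OF sets_groups refl] by (rule measurable_restrict_subset[OF J])
  then have "(\<lambda>w. (restrict (fst w) {1..K0}, snd w))
      \<in> groups J \<Otimes>\<^sub>M (MX \<Otimes>\<^sub>M MY) \<rightarrow>\<^sub>M (\<Pi>\<^sub>M k\<in>{1..K0}. grp_space MX MY) \<Otimes>\<^sub>M (MX \<Otimes>\<^sub>M MY)"
    by measurable
  from measurable_compose[OF this S]
  show "(\<lambda>(D, z). score D z) \<in> borel_measurable (groups J \<Otimes>\<^sub>M (MX \<Otimes>\<^sub>M MY))"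
    by (simp add: fitted_score_def case_prod_beta)
qed (rule space_MY_nonempty)

lemma measurable_threshold:
  assumes "{1..K0} \<subseteq> J" "H \<subseteq> J" "finite H"
  shows "(\<lambda>D. pair_threshold (score D) \<beta> H D) \<in> borel_measurable (groups J)"
proof -
  interpret measurable_scores MX MY "groups J" score by (rule measurable_scores_fitted[OF assms(1)])
  show ?thesis using assms by (intro measurable_pair_threshold measurable_group) auto
qed

lemma measurable_loo_exceed:
  assumes "k \<in> pool"
  shows "loo_exceed k \<in> borel_measurable (groups all_groups)"
proof -
  interpret measurable_scores MX MY "groups all_groups" score by (rule measurable_scores_fitted[OF index_sets(3)])
  show ?thesis
    unfolding loo_exceed_def[abs_def] using assms index_sets(1,2)
    by (intro measurable_pair_exceed measurable_group measurable_threshold index_sets(3)) auto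
qed

lemma loo_exceed_bounds: "0 \<le> loo_exceed k D" "loo_exceed k D \<le> 1"
  by (simp_all add: loo_exceed_def pair_exceed_nonneg pair_exceed_le_one)

lemma integrable_loo_exceed: "k \<in> pool \<Longrightarrow> integrable (groups all_groups) (loo_exceed k)"
proof -
  assume k: "k \<in> pool"
  interpret prob_space "groups all_groups" by (rule prob_space_groups)
  show ?thesis
    by (rule integrable_const_bound[where B = 1])
      (auto simp: loo_exceed_bounds intro: measurable_loo_exceed k)
qed

text \<open>Transposing \<open>k\<close> and \<open>K + 1\<close> preserves the product law. It fixes the training groups, hence the
  score function, and it maps the calibration groups of the one role onto those of the other.\<close>

lemma integral_loo_exceed_eq:
  assumes k: "k \<in> pool"
  shows "(\<integral>D. loo_exceed k D \<partial>groups all_groups) = (\<integral>D. loo_exceed (K+1) D \<partial>groups all_groups)"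
proof -
  define f where "f = Transposition.transpose k (K+1)"
  let ?M = "groups all_groups"
  define \<tau> where "\<tau> D = (\<lambda>n\<in>all_groups. D (f n))" for D :: "nat \<Rightarrow> ('x, 'y) grp"
  have f_in: "f \<in> all_groups \<rightarrow> all_groups" and inj: "inj_on f A" for A
    using k index_sets(2,5) by (auto simp: f_def Transposition.transpose_def[of k "Suc K"] inj_on_transpose)
  have distr: "distr ?M ?M \<tau> = ?M"
    unfolding \<tau>_def using distr_PiM_reindex[of all_groups "\<lambda>_. law" f all_groups]
      prob_space_grp_law inj f_in by simp
  have \<tau>: "\<tau> \<in> ?M \<rightarrow>\<^sub>M ?M"
    unfolding \<tau>_def using f_in by (intro measurable_restrict measurable_component_singleton) auto
  have swap: "loo_exceed (K+1) (\<tau> D) = loo_exceed k D" for D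
  proof -
    have sc: "score (\<tau> D) = score D"
    proof (rule fitted_score_cong)
      fix j assume j: "j \<in> {1..K0}"
      then have "j \<in> all_groups" using index_sets(3) by blast
      moreover have "K0 < k" using k by (simp add: pool_def)
      then have "f j = j" using j K by (simp add: f_def Transposition.transpose_def)
      ultimately show "\<tau> D j = D j" by (simp add: \<tau>_def)
    qed
    have img: "f ` (pool - {K+1}) = pool - {k}"
    proof -
      have "f ` pool = pool" unfolding f_def using k index_sets(4) by (simp add: transpose_image_eq)
      moreover have "f (K+1) = k" by (simp add: f_def)
      ultimately show ?thesis using inj_on_image_set_diff[OF inj[of UNIV], of pool "{K+1}"] by simp
    qed
    have "pair_threshold (score D) (1 - \<alpha>\<^sup>2) (pool - {K+1}) (\<tau> D)
        = pair_threshold (score D) (1 - \<alpha>\<^sup>2) (pool - {k}) D"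
      unfolding img[symmetric] using index_sets(2)
      by (intro pair_threshold_reindex[OF inj]) (auto simp: \<tau>_def)
    moreover have "\<tau> D (K+1) = D k" using index_sets(5) by (simp add: \<tau>_def f_def)
    ultimately show ?thesis by (simp add: loo_exceed_def sc)
  qed
  have "(\<integral>D. loo_exceed (K+1) D \<partial>?M) = (\<integral>D. loo_exceed (K+1) D \<partial>distr ?M ?M \<tau>)"
    by (simp add: distr)
  also have "\<dots> = (\<integral>D. loo_exceed (K+1) (\<tau> D) \<partial>?M)"
    by (intro integral_distr[OF \<tau>] measurable_loo_exceed index_sets(4))
  finally show ?thesis by (simp only: swap)
qed

lemma integral_card_big_groups:
  "(\<integral>D. real (card (big_groups pool D)) \<partial>groups all_groups) = (real K1 + 1) * p_ge2 PX PN"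
  "integrable (groups all_groups) (\<lambda>D. real (card (big_groups pool D)))"
proof -
  let ?M = "groups all_groups"
  interpret prob_space ?M by (rule prob_space_groups)
  have eq: "real (card (big_groups pool D)) = (\<Sum>k\<in>pool. of_bool (2 \<le> grp_size (D k)))"
    for D :: "nat \<Rightarrow> ('x, 'y) grp"
    using index_sets(1) by (simp add: big_groups_def sum_of_bool_eq Int_def)
  have meas: "(\<lambda>D. of_bool (2 \<le> grp_size (D k)) :: real) \<in> borel_measurable ?M" if "k \<in> pool" for k
    using that index_sets(2) by (intro measurable_compose[OF measurable_group measurable_size_ge2]) auto
  have int: "integrable ?M (\<lambda>D. of_bool (2 \<le> grp_size (D k)) :: real)" if "k \<in> pool" for k
    by (rule integrable_const_bound[where B = 1]) (auto intro: meas that)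
  have val: "(\<integral>D. of_bool (2 \<le> grp_size (D k)) \<partial>?M) = p_ge2 PX PN" if k: "k \<in> pool" for k
  proof -
    have k': "k \<in> all_groups" using k index_sets(2) by auto
    have "(\<integral>D. of_bool (2 \<le> grp_size (D k)) \<partial>?M)
        = (\<integral>g. of_bool (2 \<le> grp_size g) \<partial>distr ?M law (\<lambda>D. D k) :: real)"
      using measurable_size_ge2
      by (intro integral_distr[symmetric] measurable_component_singleton k')
        (simp add: measurable_cong_sets[OF sets_grp_law refl])
    also have "distr ?M law (\<lambda>D. D k) = law"
      by (rule distr_PiM_component[OF prob_space_grp_law k'])
    finally show ?thesis by (simp add: integral_size_ge2)
  qed
  show "integrable ?M (\<lambda>D. real (card (big_groups pool D)))"
    unfolding eq by (intro Bochner_Integration.integrable_sum int)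
  have "(\<integral>D. real (card (big_groups pool D)) \<partial>?M) = (\<Sum>k\<in>pool. p_ge2 PX PN)"
    unfolding eq by (subst Bochner_Integration.integral_sum) (auto simp: int val)
  then show "(\<integral>D. real (card (big_groups pool D)) \<partial>?M) = (real K1 + 1) * p_ge2 PX PN"
    using index_sets(6) by simp
qed

lemma cond_miscoverage_eq:
  assumes "x \<in> space MX"
  shows "cond_miscoverage MY PY S K0 K \<alpha> D x
    = measure (PY x) {y \<in> space MY. pair_threshold (score D) (1 - \<alpha>\<^sup>2) {K0+1..K} D < ereal (score D (x, y))}"
  unfolding cond_miscoverage_def hcp2_set_def hcp2_threshold_eq space_PY[OF assms]
  by (rule arg_cong[where f = "measure (PY x)"]) auto

lemma cond_miscoverage_bounds:
  assumes "x \<in> space MX"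
  shows "0 \<le> cond_miscoverage MY PY S K0 K \<alpha> D x" "cond_miscoverage MY PY S K0 K \<alpha> D x \<le> 1"
  using prob_space.prob_le_1[OF conjunct1[OF PY_at[OF assms]]] by (simp_all add: cond_miscoverage_def)

lemma sets_PX_ge2: "sets (PX_ge2 PX PN) = sets MX"
  by (simp add: PX_ge2_def sets_PX)

lemma prob_space_PX_ge2: "prob_space (PX_ge2 PX PN)"
proof -
  interpret XN: prob_space "XN_law PX PN" by (rule prob_space_XN_law)
  have "emeasure (XN_law PX PN) {\<omega> \<in> space (XN_law PX PN). 2 \<le> snd \<omega>} = ennreal (p_ge2 PX PN)"
    unfolding p_ge2_def by (rule XN.emeasure_eq_measure)
  then have "prob_space (uniform_measure (XN_law PX PN) {\<omega> \<in> space (XN_law PX PN). 2 \<le> snd \<omega>})"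
    using p by (intro prob_space_uniform_measure) auto
  moreover have "fst \<in> XN_law PX PN \<rightarrow>\<^sub>M PX"
    unfolding measurable_cong_sets[OF sets_XN_law sets_PX] by (rule measurable_fst)
  ultimately show ?thesis
    unfolding PX_ge2_def by (intro prob_space.prob_space_distr) simp_all
qed

abbreviation "sq_miscoverage \<equiv> (\<lambda>(D, x). (cond_miscoverage MY PY S K0 K \<alpha> D x)\<^sup>2)"

lemma measurable_sq_miscoverage:
  "sq_miscoverage \<in> borel_measurable (groups {1..K} \<Otimes>\<^sub>M PX_ge2 PX PN)"
proof -
  let ?W = "groups {1..K} \<Otimes>\<^sub>M MX"
  define T where "T D = pair_threshold (score D) (1 - \<alpha>\<^sup>2) {K0+1..K} D" for D
  have sub: "{1..K0} \<subseteq> {1..K}" using K by auto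
  interpret measurable_scores MX MY "groups {1..K}" score by (rule measurable_scores_fitted[OF sub])
  have [measurable]: "T \<in> borel_measurable (groups {1..K})"
    unfolding T_def by (intro measurable_threshold sub) auto
  have [measurable]: "(\<lambda>w. score (fst (fst w)) (snd (fst w), snd w)) \<in> borel_measurable (?W \<Otimes>\<^sub>M MY)"
    using measurable_compose[OF _ score, of "\<lambda>w. (fst (fst w), (snd (fst w), snd w))" "?W \<Otimes>\<^sub>M MY"]
    by simp
  have "(SIGMA w:space ?W. {y \<in> space MY. T (fst w) < ereal (score (fst w) (snd w, y))})
      = {w \<in> space (?W \<Otimes>\<^sub>M MY). T (fst (fst w)) < ereal (score (fst (fst w)) (snd (fst w), snd w))}"
    by (auto simp: space_pair_measure)
  also have "\<dots> \<in> sets (?W \<Otimes>\<^sub>M MY)" by measurable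
  finally have "(\<lambda>w. measure (PY (snd w)) {y \<in> space MY. T (fst w) < ereal (score (fst w) (snd w, y))})
      \<in> borel_measurable ?W"
    by (rule measure_measurable_prob_algebra2) (rule measurable_compose[OF measurable_snd PY])
  then have "(\<lambda>w. (measure (PY (snd w)) {y \<in> space MY. T (fst w) < ereal (score (fst w) (snd w, y))})\<^sup>2)
      \<in> borel_measurable ?W"
    by measurable
  then have meas: "sq_miscoverage \<in> borel_measurable ?W"
    by (rule measurable_cong[THEN iffD1, rotated])
      (auto simp: space_pair_measure cond_miscoverage_eq T_def)
  have "sets (groups {1..K} \<Otimes>\<^sub>M PX_ge2 PX PN) = sets ?W"
    by (rule sets_pair_measure_cong[OF refl sets_PX_ge2])
  then show ?thesis using meas measurable_cong_sets by blast
qed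

lemma loo_exceed_new_group:
  "loo_exceed (K+1) (D(K+1 := g))
    = pair_exceed (score D) (pair_threshold (score D) (1 - \<alpha>\<^sup>2) {K0+1..K} D) g"
proof -
  have "score (D(K+1 := g)) = score D" using K by (intro fitted_score_cong) auto
  moreover have "pool - {K+1} = {K0+1..K}" by (rule index_sets(7))
  moreover have "pair_threshold s \<beta> {K0+1..K} (D(K+1 := g)) = pair_threshold s \<beta> {K0+1..K} D" for s \<beta>
    by (rule pair_threshold_cong) auto
  ultimately show ?thesis by (simp add: loo_exceed_def)
qed

text \<open>The test group is independent of the data, so that for fixed data the score function and the
  threshold are constants and \<open>nn_integral_pair_exceed\<close> applies; Fubini then appends the test group
  to the data.\<close>

lemma sq_miscoverage_eq_loo:
  "p_ge2 PX PN * (\<integral>w. sq_miscoverage w \<partial>(groups {1..K} \<Otimes>\<^sub>M PX_ge2 PX PN))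
    = (\<integral>D. loo_exceed (K+1) D \<partial>groups all_groups)"
proof -
  interpret X: prob_space "PX_ge2 PX PN" by (rule prob_space_PX_ge2)
  interpret D: prob_space "groups {1..K}" by (rule prob_space_groups)
  interpret DX: pair_prob_space "groups {1..K}" "PX_ge2 PX PN" ..
  interpret G: prob_space law by (rule prob_space_grp_law)
  interpret Gs: product_sigma_finite "\<lambda>_. law" ..
  define T where "T D = pair_threshold (score D) (1 - \<alpha>\<^sup>2) {K0+1..K} D" for D
  have sub: "{1..K0} \<subseteq> {1..K}" using K by auto
  interpret measurable_scores MX MY "groups {1..K}" score by (rule measurable_scores_fitted[OF sub])
  have int: "integrable (groups {1..K} \<Otimes>\<^sub>M PX_ge2 PX PN) sq_miscoverage"
  proof (rule DX.P.integrable_const_bound[where B = 1])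
    show "AE w in groups {1..K} \<Otimes>\<^sub>M PX_ge2 PX PN. norm (sq_miscoverage w) \<le> 1"
      by (intro AE_I2)
        (auto simp: space_pair_measure sets_eq_imp_space_eq[OF sets_PX_ge2] cond_miscoverage_bounds
          intro!: power_le_one)
  qed (rule measurable_sq_miscoverage)
  have meas: "(\<lambda>w. ennreal (sq_miscoverage w)) \<in> borel_measurable (groups {1..K} \<Otimes>\<^sub>M PX_ge2 PX PN)"
    by (rule measurable_compose[OF measurable_sq_miscoverage measurable_ennreal])
  have "ennreal (p_ge2 PX PN * (\<integral>w. sq_miscoverage w \<partial>(groups {1..K} \<Otimes>\<^sub>M PX_ge2 PX PN)))
      = ennreal (p_ge2 PX PN) * (\<integral>\<^sup>+w. ennreal (sq_miscoverage w) \<partial>(groups {1..K} \<Otimes>\<^sub>M PX_ge2 PX PN))"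
    using p by (subst nn_integral_eq_integral[OF int]) (auto simp: ennreal_mult')
  also have "(\<integral>\<^sup>+w. ennreal (sq_miscoverage w) \<partial>(groups {1..K} \<Otimes>\<^sub>M PX_ge2 PX PN))
      = (\<integral>\<^sup>+D. \<integral>\<^sup>+x. ennreal (sq_miscoverage (D, x)) \<partial>PX_ge2 PX PN \<partial>groups {1..K})"
    by (rule X.nn_integral_fst[OF meas, symmetric])
  also have "ennreal (p_ge2 PX PN) * \<dots>
      = (\<integral>\<^sup>+D. ennreal (p_ge2 PX PN) * (\<integral>\<^sup>+x. ennreal (sq_miscoverage (D, x)) \<partial>PX_ge2 PX PN) \<partial>groups {1..K})"
    by (rule nn_integral_cmult[OF X.borel_measurable_nn_integral_fst[OF meas], symmetric])
  also have "\<dots> = (\<integral>\<^sup>+D. \<integral>\<^sup>+g. ennreal (pair_exceed (score D) (T D) g) \<partial>law \<partial>groups {1..K})"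
  proof (intro nn_integral_cong)
    fix D assume D: "D \<in> space (groups {1..K})"
    have s: "score D \<in> borel_measurable (MX \<Otimes>\<^sub>M MY)"
      using measurable_compose[OF measurable_Pair1'[OF D] score] by simp
    have "(\<integral>\<^sup>+x. ennreal (sq_miscoverage (D, x)) \<partial>PX_ge2 PX PN)
        = (\<integral>\<^sup>+x. ennreal ((measure (PY x) {y \<in> space MY. T D < ereal (score D (x, y))})\<^sup>2) \<partial>PX_ge2 PX PN)"
      using sets_eq_imp_space_eq[OF sets_PX_ge2]
      by (intro nn_integral_cong) (simp add: cond_miscoverage_eq T_def)
    then show "ennreal (p_ge2 PX PN) * (\<integral>\<^sup>+x. ennreal (sq_miscoverage (D, x)) \<partial>PX_ge2 PX PN)
        = (\<integral>\<^sup>+g. ennreal (pair_exceed (score D) (T D) g) \<partial>law)"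
      using nn_integral_pair_exceed[OF s p] by simp
  qed
  also have "\<dots> = (\<integral>\<^sup>+D. \<integral>\<^sup>+g. ennreal (loo_exceed (K+1) (D(K+1 := g))) \<partial>law \<partial>groups {1..K})"
    by (simp only: loo_exceed_new_group T_def)
  also have "\<dots> = (\<integral>\<^sup>+D. ennreal (loo_exceed (K+1) D) \<partial>groups all_groups)"
    unfolding index_sets(8)[symmetric]
    by (rule Gs.product_nn_integral_insert[symmetric])
      (use measurable_loo_exceed[OF index_sets(4)] in \<open>simp_all only: index_sets(8) measurable_ennreal measurable_compose[OF _ measurable_ennreal]\<close>, simp_all)
  also have "\<dots> = ennreal (\<integral>D. loo_exceed (K+1) D \<partial>groups all_groups)"
    by (intro nn_integral_eq_integral integrable_loo_exceed index_sets(4)) (simp add: loo_exceed_bounds)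
  finally show ?thesis
    using p by (subst (asm) ennreal_inj) (auto intro!: mult_nonneg_nonneg integral_nonneg_AE simp: loo_exceed_bounds)
qed

lemma sq_miscoverage_eq_sum_loo:
  "(real K1 + 1) * p_ge2 PX PN * (\<integral>w. sq_miscoverage w \<partial>(groups {1..K} \<Otimes>\<^sub>M PX_ge2 PX PN))
    = (\<integral>D. (\<Sum>k\<in>pool. loo_exceed k D) \<partial>groups all_groups)"
proof -
  have "(\<integral>D. (\<Sum>k\<in>pool. loo_exceed k D) \<partial>groups all_groups)
      = (\<Sum>k\<in>pool. \<integral>D. loo_exceed k D \<partial>groups all_groups)"
    by (intro Bochner_Integration.integral_sum integrable_loo_exceed)
  also have "\<dots> = (\<Sum>k\<in>pool. \<integral>D. loo_exceed (K+1) D \<partial>groups all_groups)"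
    by (intro sum.cong refl integral_loo_exceed_eq) simp
  also have "\<dots> = (real K1 + 1) * (\<integral>D. loo_exceed (K+1) D \<partial>groups all_groups)"
    using index_sets(6) by simp
  finally show ?thesis by (simp only: sq_miscoverage_eq_loo[symmetric] mult.assoc)
qed

lemma expected_sq_miscoverage_le:
  "(\<integral>w. sq_miscoverage w \<partial>(groups {1..K} \<Otimes>\<^sub>M PX_ge2 PX PN)) \<le> \<alpha>\<^sup>2"
proof -
  have \<beta>: "0 < 1 - \<alpha>\<^sup>2" "1 - \<alpha>\<^sup>2 < 1" using \<alpha> by (auto simp: power_less_one_iff)
  define c where "c = (real K1 + 1) * p_ge2 PX PN"
  have "0 < c" using p by (simp add: c_def)
  have "c * (\<integral>w. sq_miscoverage w \<partial>(groups {1..K} \<Otimes>\<^sub>M PX_ge2 PX PN))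
      = (\<integral>D. (\<Sum>k\<in>pool. loo_exceed k D) \<partial>groups all_groups)"
    unfolding c_def by (rule sq_miscoverage_eq_sum_loo)
  also have "\<dots> \<le> (\<integral>D. \<alpha>\<^sup>2 * real (card (big_groups pool D)) \<partial>groups all_groups)"
  proof (rule integral_mono)
    show "(\<Sum>k\<in>pool. loo_exceed k D) \<le> \<alpha>\<^sup>2 * real (card (big_groups pool D))" for D
      using leave_one_out_exceed_le[OF index_sets(1) \<beta>, of "score D" D] by (simp add: loo_exceed_def)
  qed (auto intro!: Bochner_Integration.integrable_sum integrable_loo_exceed integral_card_big_groups(2))
  also have "\<dots> = c * \<alpha>\<^sup>2"
    using integral_card_big_groups(1) by (simp add: c_def)
  finally show ?thesis using \<open>0 < c\<close> by simp
qed

lemma expected_sq_miscoverage_ge: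
  assumes "AE D in groups all_groups. all_scores_distinct S K0 (K+1) D"
  shows "\<alpha>\<^sup>2 - 2 / ((real K1 + 1) * p_ge2 PX PN)
    \<le> (\<integral>w. sq_miscoverage w \<partial>(groups {1..K} \<Otimes>\<^sub>M PX_ge2 PX PN))"
proof -
  interpret prob_space "groups all_groups" by (rule prob_space_groups)
  have \<beta>: "0 < 1 - \<alpha>\<^sup>2" using \<alpha> by (auto simp: power_less_one_iff)
  define c where "c = (real K1 + 1) * p_ge2 PX PN"
  have "0 < c" using p by (simp add: c_def)
  have "c * \<alpha>\<^sup>2 - 2 = (\<integral>D. \<alpha>\<^sup>2 * real (card (big_groups pool D)) - 2 \<partial>groups all_groups)"
    using integral_card_big_groups prob_space by (simp add: c_def)
  also have "\<dots> \<le> (\<integral>D. (\<Sum>k\<in>pool. loo_exceed k D) \<partial>groups all_groups)"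
  proof (rule integral_mono_AE)
    show "AE D in groups all_groups. \<alpha>\<^sup>2 * real (card (big_groups pool D)) - 2 \<le> (\<Sum>k\<in>pool. loo_exceed k D)"
      using assms
    proof eventually_elim
      case (elim D)
      then show ?case
        using leave_one_out_exceed_ge[OF index_sets(1) \<beta>, of "score D" D]
        by (simp add: loo_exceed_def all_scores_distinct_def pool_def)
    qed
  qed (auto intro!: Bochner_Integration.integrable_sum Bochner_Integration.integrable_diff
        integrable_loo_exceed integral_card_big_groups(2))
  also have "\<dots> = c * (\<integral>w. sq_miscoverage w \<partial>(groups {1..K} \<Otimes>\<^sub>M PX_ge2 PX PN))"
    unfolding c_def by (rule sq_miscoverage_eq_sum_loo[symmetric])
  finally have "\<alpha>\<^sup>2 - 2 / c \<le> (\<integral>w. sq_miscoverage w \<partial>(groups {1..K} \<Otimes>\<^sub>M PX_ge2 PX PN))"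
    using \<open>0 < c\<close> by (simp add: field_simps)
  then show ?thesis unfolding c_def .
qed

end

theorem theorem2:
  fixes MX :: "'x measure" and MY :: "'y measure"
    and PX :: "'x measure" and PN :: "'x \<Rightarrow> nat measure" and PY :: "'x \<Rightarrow> 'y measure"
    and S :: "(nat \<Rightarrow> ('x, 'y) grp) \<Rightarrow> 'x \<times> 'y \<Rightarrow> real"
    and K0 K1 K :: nat and \<alpha> :: real
  assumes "prob_space PX" and "sets PX = sets MX"
    and "PN \<in> MX \<rightarrow>\<^sub>M prob_algebra (count_space {1..})"
    and "PY \<in> MX \<rightarrow>\<^sub>M prob_algebra MY"
    and "(\<lambda>(D, z). S D z) \<in>
           borel_measurable ((\<Pi>\<^sub>M k\<in>{1..K0}. grp_space MX MY) \<Otimes>\<^sub>M (MX \<Otimes>\<^sub>M MY))"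
    and "0 < \<alpha>" and "\<alpha> < 1"
    and "1 \<le> K0" and "1 \<le> K1" and "K = K0 + K1"
    and "0 < p_ge2 PX PN"
  shows "(\<integral>(D, x). (cond_miscoverage MY PY S K0 K \<alpha> D x)\<^sup>2
            \<partial>(data_law MX MY PX PN PY K \<Otimes>\<^sub>M PX_ge2 PX PN)) \<le> \<alpha>\<^sup>2
       \<and> ((AE D in data_law MX MY PX PN PY (K + 1). all_scores_distinct S K0 (K + 1) D) \<longrightarrow>
            (\<integral>(D, x). (cond_miscoverage MY PY S K0 K \<alpha> D x)\<^sup>2
              \<partial>(data_law MX MY PX PN PY K \<Otimes>\<^sub>M PX_ge2 PX PN))
              \<ge> \<alpha>\<^sup>2 - 2 / ((real K1 + 1) * p_ge2 PX PN))"
proof -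
  interpret hcp2 MX MY PX PN PY S K0 K1 K \<alpha>
    using assms by (intro hcp2.intro repeated_measurements.intro hcp2_axioms.intro)
  show ?thesis
    unfolding data_law_def using expected_sq_miscoverage_le expected_sq_miscoverage_ge[unfolded all_groups_def]
    by blast
qed

end
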